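(* Let $(M,J)$ be an almost complex manifold. For every $k$, the map $[\alpha]_{d+d^c}\mapsto[\alpha^{ev}]_d+[\alpha^{od}]_d$ given by taking even and odd parts of representatives induces a decomposition of Bott-Chern cohomology $$H^k_{d+d^c}=(H^k_{d+d^c})^{ev}\oplus(H^k_{d+d^c})^{od}.$$
   Context: An almost complex manifold $(M,J)$ is a smooth $2m$-manifold with a smooth $(1,1)$-tensor field $J$, $J^2=-\mathrm{Id}$. $A^k$ is the space of smooth complex $k$-forms, with bigrading $A^k=\bigoplus_{p+q=k}A^{p,q}$ induced by $J$. $J$ acts on forms by duality, as an algebra automorphism: $J\alpha=i^{p-q}\alpha$ for $\alpha\in A^{p,q}$. Set $d^c:=J^{-1}dJ$. Let $B^\bullet:=\{\alpha\in A^\bullet:(dd^c+d^cd)\alpha=0\}$, which is preserved by $d$ and $d^c$. The Bott-Chern cohomology is $$H^k_{d+d^c}:=\frac{\ker(d\colon B^k\to B^{k+1})\cap\ker(d^c\colon B^k\to B^{k+1})}{\operatorname{Im}(dd^c\colon B^{k-2}\to B^k)}.$$ Let $A^k_{ev}:=\bigoplus_{p+q=k,\ p\text{ even}}A^{p,q}$ and $A^k_{od}:=\bigoplus_{p+q=k,\ p\text{ odd}}A^{p,q}$; write $\alpha=\alpha^{ev}+\alpha^{od}$ for the decomposition in $A^k=A^k_{ev}\oplus A^k_{od}$, and $B^k_{ev}:=B^k\cap A^k_{ev}$, $B^k_{od}:=B^k\cap A^k_{od}$. $[\cdot]_d$ denotes a de Rham class. Define $$(H^k_{d+d^c})^{ev}:=\frac{\ker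 d\cap\ker d^c\cap A^k_{ev}}{\operatorname{Im}(dd^c\colon B^{k-2}_{od}\to B^k_{ev})},\qquad(H^k_{d+d^c})^{od}:=\frac{\ker d\cap\ker d^c\cap A^k_{od}}{\operatorname{Im}(dd^c\colon B^{k-2}_{ev}\to B^k_{od})}$$ (on $B^\bullet$ the operator $dd^c$ exchanges the even and odd parts). *)

theory Defs
  imports "HOL-Analysis.Analysis" "HOL-Library.Function_Algebras" "HOL-Library.Set_Algebras"
begin

section \<open>Smooth maps and smooth manifolds\<close>

text \<open>For a finite-dimensional domain and open \<open>S\<close>, \<open>Ck_on n S f\<close> says that \<open>f\<close> is \<open>n\<close> times
  continuously differentiable on \<open>S\<close>.\<close>

primrec Ck_on :: "nat \<Rightarrow> 'e::real_normed_vector set \<Rightarrow> ('e \<Rightarrow> 'f::real_normed_vector) \<Rightarrow> bool" where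
  "Ck_on 0 S f \<longleftrightarrow> continuous_on S f"
| "Ck_on (Suc n) S f \<longleftrightarrow>
     (\<forall>x\<in>S. f differentiable (at x)) \<and> (\<forall>v. Ck_on n S (\<lambda>x. frechet_derivative f (at x) v))"

definition smooth_on :: "'e::real_normed_vector set \<Rightarrow> ('e \<Rightarrow> 'f::real_normed_vector) \<Rightarrow> bool" where
  "smooth_on S f \<longleftrightarrow> (\<forall>n. Ck_on n S f)"

text \<open>A chart is a coordinate domain together with a coordinate map, whose values off the domain
  are irrelevant.\<close>

type_synonym ('a, 'e) chart = "'a set \<times> ('a \<Rightarrow> 'e)"

definition chart_image :: "('a, 'e) chart \<Rightarrow> 'e set" where
  "chart_image c = snd c ` fst c"

definition overlap :: "('a, 'e) chart \<Rightarrow> ('a, 'e) chart \<Rightarrow> 'e set" where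
  "overlap c d = snd c ` (fst c \<inter> fst d)"

definition transition :: "('a, 'e) chart \<Rightarrow> ('a, 'e) chart \<Rightarrow> 'e \<Rightarrow> 'e" where
  "transition c d = snd d \<circ> inv_into (fst c) (snd c)"

abbreviation transition_deriv ::
    "('a, 'e::real_normed_vector) chart \<Rightarrow> ('a, 'e) chart \<Rightarrow> 'e \<Rightarrow> 'e \<Rightarrow> 'e" where
  "transition_deriv c d x \<equiv> frechet_derivative (transition c d) (at x)"

definition is_chart :: "'a topology \<Rightarrow> ('a, 'e::real_normed_vector) chart \<Rightarrow> bool" where
  "is_chart X c \<longleftrightarrow> openin X (fst c) \<and> open (chart_image c) \<and>
     homeomorphic_map (subtopology X (fst c)) (top_of_set (chart_image c)) (snd c)"

text \<open>The model space is any real inner product space of dimension \<open>n\<close>. The class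
  \<open>euclidean_space\<close> is avoided only because it excludes \<open>n = 0\<close>. The atlas need not be maximal.\<close>

definition smooth_manifold ::
    "nat \<Rightarrow> 'a topology \<Rightarrow> ('a, 'e::real_inner) chart set \<Rightarrow> bool" where
  "smooth_manifold n X atlas \<longleftrightarrow>
     (\<exists>Bs :: 'e set. finite Bs \<and> independent Bs \<and> span Bs = UNIV \<and> card Bs = n) \<and>
     Hausdorff_space X \<and> second_countable X \<and>
     (\<forall>c\<in>atlas. is_chart X c) \<and> (\<Union>c\<in>atlas. fst c) = topspace X \<and>
     (\<forall>c\<in>atlas. \<forall>d\<in>atlas. smooth_on (overlap c d) (transition c d))"


section \<open>Almost complex structures\<close>

text \<open>A tensor field is given by its representatives in the charts of the atlas, subject to the
  transformation law on overlaps. For an endomorphism field, \<open>K c x\<close> is the endomorphism in the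
  chart \<open>c\<close> at the point with coordinates \<open>x\<close>.\<close>

type_synonym ('a, 'e) endo_field = "('a, 'e) chart \<Rightarrow> 'e \<Rightarrow> 'e \<Rightarrow> 'e"

definition almost_complex_structure ::
    "('a, 'e::real_normed_vector) chart set \<Rightarrow> ('a, 'e) endo_field \<Rightarrow> bool" where
  "almost_complex_structure atlas J \<longleftrightarrow>
     (\<forall>c\<in>atlas. \<forall>x\<in>chart_image c. linear (J c x)) \<and>
     (\<forall>c\<in>atlas. \<forall>v. smooth_on (chart_image c) (\<lambda>x. J c x v)) \<and>
     (\<forall>c\<in>atlas. \<forall>d\<in>atlas. \<forall>x\<in>overlap c d. \<forall>v.
        transition_deriv c d x (J c x v) = J d (transition c d x) (transition_deriv c d x v)) \<and>
     (\<forall>c\<in>atlas. \<forall>x\<in>chart_image c. \<forall>v. J c x (J c x v) = - v)"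

definition almost_complex_manifold ::
    "nat \<Rightarrow> 'a topology \<Rightarrow> ('a, 'e::real_inner) chart set \<Rightarrow> ('a, 'e) endo_field \<Rightarrow> bool" where
  "almost_complex_manifold m X atlas J \<longleftrightarrow>
     smooth_manifold (2 * m) X atlas \<and> almost_complex_structure atlas J"


section \<open>Complex differential forms\<close>

text \<open>\<open>\<alpha> c x [v\<^sub>1, \<dots>, v\<^sub>k]\<close> is the value of the representative of \<open>\<alpha>\<close> in the chart \<open>c\<close> at \<open>x\<close> on the
  tangent vectors \<open>v\<^sub>1, \<dots>, v\<^sub>k\<close>. Forms are normalised to vanish on all arguments without meaning
  (wrong number of vectors, \<open>x\<close> outside the chart image, \<open>c\<close> outside the atlas), so that equality
  of functions is equality of forms.\<close>

type_synonym ('a, 'e) form = "('a, 'e) chart \<Rightarrow> 'e \<Rightarrow> 'e list \<Rightarrow> complex"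

definition alternating_multilinear ::
    "nat \<Rightarrow> ('e::real_vector list \<Rightarrow> complex) \<Rightarrow> bool" where
  "alternating_multilinear k f \<longleftrightarrow>
     (\<forall>vs. length vs \<noteq> k \<longrightarrow> f vs = 0) \<and>
     (\<forall>vs i. length vs = k \<and> i < k \<longrightarrow> linear (\<lambda>v. f (vs[i := v]))) \<and>
     (\<forall>vs i j. length vs = k \<and> i < j \<and> j < k \<and> vs ! i = vs ! j \<longrightarrow> f vs = 0)"

definition A :: "('a, 'e::real_normed_vector) chart set \<Rightarrow> nat \<Rightarrow> ('a, 'e) form set" where
  "A atlas k = {\<alpha>.
     (\<forall>c x. c \<notin> atlas \<or> x \<notin> chart_image c \<longrightarrow> (\<forall>vs. \<alpha> c x vs = 0)) \<and>
     (\<forall>c\<in>atlas. \<forall>x\<in>chart_image c. alternating_multilinear k (\<alpha> c x)) \<and>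
     (\<forall>c\<in>atlas. \<forall>vs. smooth_on (chart_image c) (\<lambda>x. \<alpha> c x vs)) \<and>
     (\<forall>c\<in>atlas. \<forall>d\<in>atlas. \<forall>x\<in>overlap c d. \<forall>vs.
        \<alpha> c x vs = \<alpha> d (transition c d x) (map (transition_deriv c d x) vs))}"

definition scale_form :: "complex \<Rightarrow> ('a, 'e) form \<Rightarrow> ('a, 'e) form" where
  "scale_form a \<alpha> = (\<lambda>c x vs. a * \<alpha> c x vs)"

text \<open>The exterior derivative, computed in each chart:
  \<open>(d\<alpha>)\<^sub>x(v\<^sub>0, \<dots>, v\<^sub>k) = \<Sum>\<^sub>i (-1)\<^sup>i D(y \<mapsto> \<alpha>\<^sub>y(v\<^sub>0, \<dots>, v\<^sub>i omitted, \<dots>, v\<^sub>k))\<^sub>x(v\<^sub>i)\<close>.\<close>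

definition ext_d :: "('a, 'e::real_normed_vector) form \<Rightarrow> ('a, 'e) form" where
  "ext_d \<alpha> = (\<lambda>c x vs. if x \<in> chart_image c
     then \<Sum>i<length vs. (-1) ^ i *
            frechet_derivative (\<lambda>y. \<alpha> c y (take i vs @ drop (Suc i) vs)) (at x) (vs ! i)
     else 0)"

text \<open>The algebra automorphism of the forms dual to an endomorphism field.\<close>

definition act :: "('a, 'e) endo_field \<Rightarrow> ('a, 'e) form \<Rightarrow> ('a, 'e) form" where
  "act K \<alpha> = (\<lambda>c x vs. \<alpha> c x (map (K c x) vs))"

text \<open>\<open>d\<^sup>c = J\<^sup>-\<^sup>1 d J\<close>; the endomorphism inverse to \<open>J\<close> is \<open>-J\<close>.\<close>

definition ext_dc ::
    "('a, 'e) endo_field \<Rightarrow> ('a, 'e::real_normed_vector) form \<Rightarrow> ('a, 'e) form" where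
  "ext_dc J \<alpha> = act (\<lambda>c x v. - J c x v) (ext_d (act J \<alpha>))"


section \<open>The bigrading\<close>

text \<open>The pair \<open>(u, v)\<close> stands for \<open>u + \<i>v\<close> in the complexified tangent space;
  \<open>complexify f\<close> is the complex multilinear extension of \<open>f\<close>.\<close>

fun complexify :: "('e list \<Rightarrow> complex) \<Rightarrow> ('e \<times> 'e) list \<Rightarrow> complex" where
  "complexify f [] = f []"
| "complexify f ((u, v) # zs) =
     complexify (\<lambda>ws. f (u # ws)) zs + \<i> * complexify (\<lambda>ws. f (v # ws)) zs"

text \<open>The eigenspaces of \<open>J\<close> for \<open>\<i>\<close> and \<open>-\<i>\<close>.\<close>

definition T10 :: "('e \<Rightarrow> 'e) \<Rightarrow> ('e::real_vector \<times> 'e) set" where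
  "T10 Jx = {(u, v). Jx u = - v \<and> Jx v = u}"

definition T01 :: "('e \<Rightarrow> 'e) \<Rightarrow> ('e::real_vector \<times> 'e) set" where
  "T01 Jx = {(u, v). Jx u = v \<and> Jx v = - u}"

text \<open>\<open>A\<^sup>p\<^sup>,\<^sup>q\<close>: the \<open>(p+q)\<close>-forms that vanish on \<open>r\<close> vectors of type \<open>(1,0)\<close> and \<open>s\<close> vectors of type
  \<open>(0,1)\<close> whenever \<open>r + s = p + q\<close> and \<open>(r, s) \<noteq> (p, q)\<close>.\<close>

definition Apq ::
    "('a, 'e::real_normed_vector) chart set \<Rightarrow> ('a, 'e) endo_field \<Rightarrow> nat \<Rightarrow> nat \<Rightarrow> ('a, 'e) form set" where
  "Apq atlas J p q = {\<alpha> \<in> A atlas (p + q).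
     \<forall>c\<in>atlas. \<forall>x\<in>chart_image c. \<forall>zs ws.
       set zs \<subseteq> T10 (J c x) \<and> set ws \<subseteq> T01 (J c x) \<and>
       length zs + length ws = p + q \<and> length zs \<noteq> p \<longrightarrow> complexify (\<alpha> c x) (zs @ ws) = 0}"

definition A_ev ::
    "('a, 'e::real_normed_vector) chart set \<Rightarrow> ('a, 'e) endo_field \<Rightarrow> nat \<Rightarrow> ('a, 'e) form set" where
  "A_ev atlas J k =
     {\<Sum>p | p \<le> k \<and> even p. \<beta> p |\<beta>. \<forall>p\<le>k. even p \<longrightarrow> \<beta> p \<in> Apq atlas J p (k - p)}"

definition A_od ::
    "('a, 'e::real_normed_vector) chart set \<Rightarrow> ('a, 'e) endo_field \<Rightarrow> nat \<Rightarrow> ('a, 'e) form set" where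
  "A_od atlas J k =
     {\<Sum>p | p \<le> k \<and> odd p. \<beta> p |\<beta>. \<forall>p\<le>k. odd p \<longrightarrow> \<beta> p \<in> Apq atlas J p (k - p)}"

definition ev_part ::
    "('a, 'e::real_normed_vector) chart set \<Rightarrow> ('a, 'e) endo_field \<Rightarrow> nat \<Rightarrow> ('a, 'e) form \<Rightarrow> ('a, 'e) form" where
  "ev_part atlas J k \<alpha> = (THE \<beta>. \<beta> \<in> A_ev atlas J k \<and> (\<exists>\<gamma>\<in>A_od atlas J k. \<alpha> = \<beta> + \<gamma>))"

definition od_part ::
    "('a, 'e::real_normed_vector) chart set \<Rightarrow> ('a, 'e) endo_field \<Rightarrow> nat \<Rightarrow> ('a, 'e) form \<Rightarrow> ('a, 'e) form" where
  "od_part atlas J k \<alpha> = (THE \<gamma>. \<gamma> \<in> A_od atlas J k \<and> (\<exists>\<beta>\<in>A_ev atlas J k. \<alpha> = \<beta> + \<gamma>))"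


section \<open>Quotients of spaces of forms\<close>

definition coset :: "('a, 'e) form set \<Rightarrow> ('a, 'e) form \<Rightarrow> ('a, 'e) form set" where
  "coset I \<alpha> = {\<beta>. \<beta> - \<alpha> \<in> I}"

text \<open>The quotient \<open>Z/I\<close> is a set of cosets; the sum of two cosets is their Minkowski sum.\<close>

definition quot :: "('a, 'e) form set \<Rightarrow> ('a, 'e) form set \<Rightarrow> ('a, 'e) form set set" where
  "quot Z I = coset I ` Z"

definition coset_scale ::
    "('a, 'e) form set \<Rightarrow> complex \<Rightarrow> ('a, 'e) form set \<Rightarrow> ('a, 'e) form set" where
  "coset_scale I a C = {scale_form a \<alpha> + \<iota> |\<alpha> \<iota>. \<alpha> \<in> C \<and> \<iota> \<in> I}"

definition quot_linear ::
    "('a, 'e) form set \<Rightarrow> ('a, 'e) form set \<Rightarrow> ('a, 'e) form set \<Rightarrow> ('a, 'e) form set \<Rightarrow>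
     (('a, 'e) form set \<Rightarrow> ('a, 'e) form set) \<Rightarrow> bool" where
  "quot_linear Z I Z' I' F \<longleftrightarrow>
     (\<forall>C\<in>quot Z I. F C \<in> quot Z' I') \<and>
     (\<forall>C\<in>quot Z I. \<forall>D\<in>quot Z I. F (C + D) = F C + F D) \<and>
     (\<forall>a. \<forall>C\<in>quot Z I. F (coset_scale I a C) = coset_scale I' a (F C))"


section \<open>Cohomology\<close>

definition dR_cocycles ::
    "('a, 'e::real_normed_vector) chart set \<Rightarrow> nat \<Rightarrow> ('a, 'e) form set" where
  "dR_cocycles atlas k = {\<alpha> \<in> A atlas k. ext_d \<alpha> = 0}"

definition dR_coboundaries ::
    "('a, 'e::real_normed_vector) chart set \<Rightarrow> nat \<Rightarrow> ('a, 'e) form set" where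
  "dR_coboundaries atlas k = (if k = 0 then {0} else ext_d ` A atlas (k - 1))"

definition B ::
    "('a, 'e::real_normed_vector) chart set \<Rightarrow> ('a, 'e) endo_field \<Rightarrow> nat \<Rightarrow> ('a, 'e) form set" where
  "B atlas J k = {\<alpha> \<in> A atlas k. ext_d (ext_dc J \<alpha>) + ext_dc J (ext_d \<alpha>) = 0}"

definition BC_cocycles ::
    "('a, 'e::real_normed_vector) chart set \<Rightarrow> ('a, 'e) endo_field \<Rightarrow> nat \<Rightarrow> ('a, 'e) form set" where
  "BC_cocycles atlas J k = {\<alpha> \<in> B atlas J k. ext_d \<alpha> = 0 \<and> ext_dc J \<alpha> = 0}"

text \<open>The image under \<open>dd\<^sup>c\<close> of the degree \<open>k - 2\<close> part of a family \<open>S\<close> of spaces of forms, which is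
  zero in negative degrees.\<close>

definition ddc_image ::
    "('a, 'e::real_normed_vector) endo_field \<Rightarrow> (nat \<Rightarrow> ('a, 'e) form set) \<Rightarrow> nat \<Rightarrow> ('a, 'e) form set" where
  "ddc_image J S k = (if k < 2 then {0} else (\<lambda>\<eta>. ext_d (ext_dc J \<eta>)) ` S (k - 2))"

definition BC_coboundaries ::
    "('a, 'e::real_normed_vector) chart set \<Rightarrow> ('a, 'e) endo_field \<Rightarrow> nat \<Rightarrow> ('a, 'e) form set" where
  "BC_coboundaries atlas J = ddc_image J (B atlas J)"

definition BC_cocycles_ev ::
    "('a, 'e::real_normed_vector) chart set \<Rightarrow> ('a, 'e) endo_field \<Rightarrow> nat \<Rightarrow> ('a, 'e) form set" where
  "BC_cocycles_ev atlas J k = BC_cocycles atlas J k \<inter> A_ev atlas J k"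

definition BC_cocycles_od ::
    "('a, 'e::real_normed_vector) chart set \<Rightarrow> ('a, 'e) endo_field \<Rightarrow> nat \<Rightarrow> ('a, 'e) form set" where
  "BC_cocycles_od atlas J k = BC_cocycles atlas J k \<inter> A_od atlas J k"

definition BC_coboundaries_ev ::
    "('a, 'e::real_normed_vector) chart set \<Rightarrow> ('a, 'e) endo_field \<Rightarrow> nat \<Rightarrow> ('a, 'e) form set" where
  "BC_coboundaries_ev atlas J = ddc_image J (\<lambda>j. B atlas J j \<inter> A_od atlas J j)"

definition BC_coboundaries_od ::
    "('a, 'e::real_normed_vector) chart set \<Rightarrow> ('a, 'e) endo_field \<Rightarrow> nat \<Rightarrow> ('a, 'e) form set" where
  "BC_coboundaries_od atlas J = ddc_image J (\<lambda>j. B atlas J j \<inter> A_ev atlas J j)"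

definition H_BC ::
    "('a, 'e::real_normed_vector) chart set \<Rightarrow> ('a, 'e) endo_field \<Rightarrow> nat \<Rightarrow> ('a, 'e) form set set" where
  "H_BC atlas J k = quot (BC_cocycles atlas J k) (BC_coboundaries atlas J k)"

definition H_BC_ev ::
    "('a, 'e::real_normed_vector) chart set \<Rightarrow> ('a, 'e) endo_field \<Rightarrow> nat \<Rightarrow> ('a, 'e) form set set" where
  "H_BC_ev atlas J k = quot (BC_cocycles_ev atlas J k) (BC_coboundaries_ev atlas J k)"

definition H_BC_od ::
    "('a, 'e::real_normed_vector) chart set \<Rightarrow> ('a, 'e) endo_field \<Rightarrow> nat \<Rightarrow> ('a, 'e) form set set" where
  "H_BC_od atlas J k = quot (BC_cocycles_od atlas J k) (BC_coboundaries_od atlas J k)"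

end

theory Submission
  imports Defs
begin

text \<open>On \<open>A\<^sup>k\<close> the operator \<open>J\<close> acts on type \<open>(p, q)\<close> as \<open>\<i>\<^sup>p (- \<i>)\<^sup>q = (-1)\<^sup>p (- \<i>)\<^sup>k\<close>, so the even and odd forms are
  exactly its two eigenspaces and the projections onto them are the combinations
  \<open>(\<alpha> \<plusminus> \<i>\<^sup>k J\<alpha>) / 2\<close> of the identity and \<open>J\<close>. Since \<open>J\<^sup>-\<^sup>1 = \<plusminus>J\<close> in each degree, the conditions
  \<open>d\<alpha> = d\<^sup>c\<alpha> = 0\<close> and \<open>(dd\<^sup>c + d\<^sup>cd)\<alpha> = 0\<close> amount to \<open>d\<alpha> = dJ\<alpha> = 0\<close> and \<open>dJdJ\<alpha> = JdJd\<alpha>\<close>. Both are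
  invariant under \<open>J\<close>, hence under the projections, and the second one makes \<open>dd\<^sup>c\<close> exchange the
  eigenspaces. So the parts of a cocycle are cocycles, and those of \<open>dd\<^sup>c\<eta>\<close> are the images under
  \<open>dd\<^sup>c\<close> of the parts of \<open>\<eta>\<close> of opposite parity.\<close>

section \<open>Calculus of smooth maps\<close>

text \<open>\<open>A_ev\<close> and \<open>A_od\<close> are defined as sums of the spaces
  \<open>Apq\<close>, and \<open>Apq\<close> only by the vanishing of certain values. Describing
  them as eigenspaces of J therefore takes two facts: J is a scalar on each \<open>Apq\<close>, and
  every smooth form is a sum of smooth forms of pure type. The second is obtained by averaging over
  the endomorphisms exp(tJ) of the real tangent spaces: these inherit smoothness and the
  transformation law from J, so the averages are global smooth forms without any choice of local
  frames of type (1,0). J need not be integrable, so d can shift the bidegree in more ways than by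
  (1,0) and (0,1). The argument never splits d into types; it uses only that J squares to a sign in
  each degree. The analytic work serves to show that d and J map forms to forms. For d, the
  transformation law rests on the symmetry of second derivatives and on a product rule for
  multilinear maps with varying arguments. The model space is only known to be an inner product
  space with a finite spanning set, so the arguments are expanded in an orthogonal spanning
  set.\<close>

lemma Ck_on_imp_continuous_on: "Ck_on n S f \<Longrightarrow> continuous_on S f"
  by (cases n) (auto intro!: continuous_at_imp_continuous_on differentiable_imp_continuous_within)

lemma Ck_on_SucD: "Ck_on (Suc n) S f \<Longrightarrow> Ck_on n S f"
proof (induction n arbitrary: f)
  case 0
  then show ?case using Ck_on_imp_continuous_on[of 1] by simp
qed auto

text \<open>Since \<open>S\<close> is open, \<open>f\<close> and \<open>g\<close> agree near each
  point of \<open>S\<close> and so have the same derivatives there. The closure proofs below use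
  this to replace a \<open>frechet_derivative\<close> by a formula that is known only on
  \<open>S\<close>.\<close>

lemma Ck_on_cong:
  assumes "open S" "\<And>x. x \<in> S \<Longrightarrow> f x = g x" "Ck_on n S f"
  shows "Ck_on n S g"
  using assms(2,3)
proof (induction n arbitrary: f g)
  case 0
  then show ?case by (simp cong: continuous_on_cong)
next
  case (Suc n)
  have D: "(g has_derivative frechet_derivative f (at x)) (at x)" if "x \<in> S" for x
    using Suc.prems that frechet_derivative_works assms(1)
    by (metis Ck_on.simps(2) has_derivative_transform_within_open)
  then have "frechet_derivative f (at x) = frechet_derivative g (at x)" if "x \<in> S" for x
    using frechet_derivative_at that by blast
  then show ?case
    using D Suc by (simp add: differentiable_def) (metis (no_types, lifting))
qed

lemma Ck_on_const: "Ck_on n S (\<lambda>x. c)"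
  by (induction n arbitrary: c) auto

lemma Ck_on_add:
  assumes "open S" "Ck_on n S f" "Ck_on n S g"
  shows "Ck_on n S (\<lambda>x. f x + g x)"
  using assms(2,3)
proof (induction n arbitrary: f g)
  case 0
  then show ?case by (simp add: continuous_on_add)
next
  case (Suc n)
  have D: "((\<lambda>x. f x + g x) has_derivative
      (\<lambda>v. frechet_derivative f (at x) v + frechet_derivative g (at x) v)) (at x)" if "x \<in> S" for x
    using Suc.prems that by (auto intro!: has_derivative_add simp flip: frechet_derivative_works)
  have "Ck_on n S (\<lambda>x. frechet_derivative (\<lambda>x. f x + g x) (at x) v)" for v
    by (rule Ck_on_cong[OF assms(1) _ Suc.IH[of "\<lambda>x. frechet_derivative f (at x) v"
            "\<lambda>x. frechet_derivative g (at x) v"]])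
      (use Suc.prems in \<open>auto simp flip: frechet_derivative_at[OF D]\<close>)
  then show ?case using D by (auto simp: differentiable_def)
qed

lemma (in bounded_linear) Ck_on:
  assumes "open S" "Ck_on n S g"
  shows "Ck_on n S (\<lambda>x. f (g x))"
  using assms(2)
proof (induction n arbitrary: g)
  case 0
  then show ?case by (simp add: continuous_on)
next
  case (Suc n)
  have D: "((\<lambda>x. f (g x)) has_derivative (\<lambda>v. f (frechet_derivative g (at x) v))) (at x)"
    if "x \<in> S" for x
    using Suc.prems that by (auto intro!: has_derivative simp flip: frechet_derivative_works)
  have "Ck_on n S (\<lambda>x. frechet_derivative (\<lambda>x. f (g x)) (at x) v)" for v
    by (rule Ck_on_cong[OF assms(1) _ Suc.IH[of "\<lambda>x. frechet_derivative g (at x) v"]])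
      (use Suc.prems in \<open>auto simp flip: frechet_derivative_at[OF D]\<close>)
  then show ?case using D by (auto simp: differentiable_def)
qed

lemma (in bounded_bilinear) Ck_on:
  assumes "open S" "Ck_on n S f" "Ck_on n S g"
  shows "Ck_on n S (\<lambda>x. prod (f x) (g x))"
  using assms(2,3)
proof (induction n arbitrary: f g)
  case 0
  then show ?case by (simp add: continuous_on)
next
  case (Suc n)
  have D: "((\<lambda>x. prod (f x) (g x)) has_derivative
      (\<lambda>v. prod (f x) (frechet_derivative g (at x) v) + prod (frechet_derivative f (at x) v) (g x))) (at x)"
    if "x \<in> S" for x
    using Suc.prems that by (auto intro!: FDERIV simp flip: frechet_derivative_works)
  have "Ck_on n S (\<lambda>x. frechet_derivative (\<lambda>x. prod (f x) (g x)) (at x) v)" for v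
  proof (rule Ck_on_cong[OF assms(1)])
    \<comment> \<open>Each term of the product rule keeps one factor undifferentiated, so
      \<open>f\<close> and \<open>g\<close> themselves must be known to be of order
      \<open>n\<close>; this comes from \<open>Ck_on_SucD\<close>.\<close>
    show "Ck_on n S (\<lambda>x. prod (f x) (frechet_derivative g (at x) v)
        + prod (frechet_derivative f (at x) v) (g x))"
      using Suc.prems Ck_on_SucD[OF Suc.prems(1)] Ck_on_SucD[OF Suc.prems(2)]
      by (intro Ck_on_add[OF assms(1)] Suc.IH) auto
  qed (simp flip: frechet_derivative_at[OF D])
  then show ?case using D by (auto simp: differentiable_def)
qed

lemma smooth_on_differentiable: "smooth_on S f \<Longrightarrow> x \<in> S \<Longrightarrow> f differentiable (at x)"
  unfolding smooth_on_def by (metis Ck_on.simps(2))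

lemma smooth_on_has_derivative:
  "smooth_on S f \<Longrightarrow> x \<in> S \<Longrightarrow> (f has_derivative frechet_derivative f (at x)) (at x)"
  using smooth_on_differentiable frechet_derivative_works by blast

lemma smooth_on_frechet_derivative:
  "smooth_on S f \<Longrightarrow> smooth_on S (\<lambda>x. frechet_derivative f (at x) v)"
  unfolding smooth_on_def by (metis Ck_on.simps(2))

lemma smooth_on_continuous_on: "smooth_on S f \<Longrightarrow> continuous_on S f"
  unfolding smooth_on_def using Ck_on_imp_continuous_on by blast

lemma smooth_on_cong:
  "open S \<Longrightarrow> (\<And>x. x \<in> S \<Longrightarrow> f x = g x) \<Longrightarrow> smooth_on S f \<Longrightarrow> smooth_on S g"
  unfolding smooth_on_def using Ck_on_cong by blast

lemma smooth_on_const: "smooth_on S (\<lambda>x. c)"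
  unfolding smooth_on_def by (simp add: Ck_on_const)

lemma smooth_on_add:
  "open S \<Longrightarrow> smooth_on S f \<Longrightarrow> smooth_on S g \<Longrightarrow> smooth_on S (\<lambda>x. f x + g x)"
  unfolding smooth_on_def using Ck_on_add by blast

lemma (in bounded_linear) smooth_on:
  "open S \<Longrightarrow> smooth_on S g \<Longrightarrow> smooth_on S (\<lambda>x. f (g x))"
  unfolding smooth_on_def using Ck_on by blast

lemma (in bounded_bilinear) smooth_on:
  "open S \<Longrightarrow> smooth_on S f \<Longrightarrow> smooth_on S g \<Longrightarrow> smooth_on S (\<lambda>x. prod (f x) (g x))"
  unfolding smooth_on_def using Ck_on by blast

lemmas smooth_on_scaleR = bounded_bilinear.smooth_on[OF bounded_bilinear_scaleR]
  and smooth_on_mult = bounded_bilinear.smooth_on[OF bounded_bilinear_mult]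
  and smooth_on_inner_left = bounded_linear.smooth_on[OF bounded_linear_inner_left]

lemma smooth_on_sum:
  "open S \<Longrightarrow> (\<And>i. i \<in> I \<Longrightarrow> smooth_on S (f i)) \<Longrightarrow> smooth_on S (\<lambda>x. \<Sum>i\<in>I. f i x)"
  by (induction I rule: infinite_finite_induct) (auto simp: smooth_on_const smooth_on_add)

section \<open>Symmetry of second derivatives\<close>

text \<open>Two applications of the mean value theorem to the second difference of \<open>g\<close>.\<close>

lemma second_difference_eq:
  fixes g :: "'e::real_normed_vector \<Rightarrow> real"
  assumes g: "smooth_on S g" and h: "0 < h"
    and sub: "\<And>s t. \<bar>s\<bar> \<le> h \<Longrightarrow> \<bar>t\<bar> \<le> h \<Longrightarrow> x + s *\<^sub>R v + t *\<^sub>R w \<in> S"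
  shows "\<exists>s t. \<bar>s\<bar> \<le> h \<and> \<bar>t\<bar> \<le> h \<and>
    g (x + h *\<^sub>R v + h *\<^sub>R w) - g (x + h *\<^sub>R v) - g (x + h *\<^sub>R w) + g x =
      h * h * frechet_derivative (\<lambda>y. frechet_derivative g (at y) v) (at (x + s *\<^sub>R v + t *\<^sub>R w)) w"
proof -
  let ?Dv = "\<lambda>y. frechet_derivative g (at y) v"
  have Dg: "((\<lambda>s. g (x + s *\<^sub>R v + t *\<^sub>R w)) has_real_derivative ?Dv (x + s *\<^sub>R v + t *\<^sub>R w)) (at s)"
    if "\<bar>s\<bar> \<le> h" "\<bar>t\<bar> \<le> h" for s t
  proof -
    let ?y = "x + s *\<^sub>R v + t *\<^sub>R w"
    have 1: "((\<lambda>s. x + s *\<^sub>R v + t *\<^sub>R w) has_derivative (\<lambda>c. c *\<^sub>R v)) (at s)"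
      by (auto intro!: derivative_eq_intros)
    have 2: "(g has_derivative frechet_derivative g (at ?y)) (at ?y)"
      using smooth_on_has_derivative[OF g sub[OF that]] .
    show ?thesis
      using has_derivative_compose[OF 1 2] has_derivative_bounded_linear[OF 2]
      by (simp add: has_field_derivative_def linear_simps(5) mult.commute[of _ "frechet_derivative _ _ _"])
  qed
  have DDg: "((\<lambda>t. ?Dv (x + s *\<^sub>R v + t *\<^sub>R w)) has_real_derivative
      frechet_derivative ?Dv (at (x + s *\<^sub>R v + t *\<^sub>R w)) w) (at t)"
    if "\<bar>s\<bar> \<le> h" "\<bar>t\<bar> \<le> h" for s t
  proof -
    let ?y = "x + s *\<^sub>R v + t *\<^sub>R w"
    have 1: "((\<lambda>t. x + s *\<^sub>R v + t *\<^sub>R w) has_derivative (\<lambda>c. c *\<^sub>R w)) (at t)"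
      by (auto intro!: derivative_eq_intros)
    have 2: "(?Dv has_derivative frechet_derivative ?Dv (at ?y)) (at ?y)"
      using smooth_on_has_derivative[OF smooth_on_frechet_derivative[OF g] sub[OF that]] .
    show ?thesis
      using has_derivative_compose[OF 1 2] has_derivative_bounded_linear[OF 2]
      by (simp add: has_field_derivative_def linear_simps(5) mult.commute[of _ "frechet_derivative _ _ _"])
  qed
  \<comment> \<open>The increment of \<open>g\<close> in the direction \<open>w\<close>. The summand
    \<open>0 *\<^sub>R w\<close> is kept so that both terms match \<open>Dg\<close>, with
    \<open>t = h\<close> and \<open>t = 0\<close>. The first mean value step acts on
    \<open>s\<close>, the second on \<open>t\<close>.\<close>
  define \<phi> where "\<phi> s = g (x + s *\<^sub>R v + h *\<^sub>R w) - g (x + s *\<^sub>R v + 0 *\<^sub>R w)" for s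
  have "\<exists>s>0. s < h \<and> \<phi> h - \<phi> 0 =
      (h - 0) * (?Dv (x + s *\<^sub>R v + h *\<^sub>R w) - ?Dv (x + s *\<^sub>R v + 0 *\<^sub>R w))"
    unfolding \<phi>_def using h by (intro MVT2 DERIV_diff Dg) auto
  then obtain s where s: "0 < s" "s < h" and
    1: "\<phi> h - \<phi> 0 = h * (?Dv (x + s *\<^sub>R v + h *\<^sub>R w) - ?Dv (x + s *\<^sub>R v + 0 *\<^sub>R w))"
    by auto
  have "\<exists>t>0. t < h \<and> ?Dv (x + s *\<^sub>R v + h *\<^sub>R w) - ?Dv (x + s *\<^sub>R v + 0 *\<^sub>R w) =
      (h - 0) * frechet_derivative ?Dv (at (x + s *\<^sub>R v + t *\<^sub>R w)) w"
    using h s by (intro MVT2 DDg) auto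
  then obtain t where t: "0 < t" "t < h" and
    2: "?Dv (x + s *\<^sub>R v + h *\<^sub>R w) - ?Dv (x + s *\<^sub>R v + 0 *\<^sub>R w) =
      h * frechet_derivative ?Dv (at (x + s *\<^sub>R v + t *\<^sub>R w)) w"
    by auto
  show ?thesis
    using 1 2 s t by (intro exI[of _ s] exI[of _ t]) (simp add: \<phi>_def)
qed

text \<open>The second difference of \<open>g\<close> is symmetric in \<open>v\<close> and
  \<open>w\<close>. By \<open>second_difference_eq\<close> it equals \<open>h * h\<close> times
  either mixed derivative at a point close to \<open>x\<close>, so by continuity the two mixed
  derivatives agree at \<open>x\<close>.\<close>

lemma symmetric_second_derivative_real:
  fixes g :: "'e::real_normed_vector \<Rightarrow> real"
  assumes "open S" "smooth_on S g" "x \<in> S"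
  shows "frechet_derivative (\<lambda>y. frechet_derivative g (at y) v) (at x) w =
    frechet_derivative (\<lambda>y. frechet_derivative g (at y) w) (at x) v"
proof -
  define P where "P y = frechet_derivative (\<lambda>y. frechet_derivative g (at y) v) (at y) w" for y
  define Q where "Q y = frechet_derivative (\<lambda>y. frechet_derivative g (at y) w) (at y) v" for y
  have cont: "isCont P x" "isCont Q x"
    using assms unfolding P_def Q_def
    by (auto intro!: continuous_on_interior[of S] smooth_on_continuous_on smooth_on_frechet_derivative
        simp: interior_open)
  have "P x = Q x"
  proof (rule ccontr)
    assume "P x \<noteq> Q x"
    \<comment> \<open>Half the gap: values of \<open>P\<close> and \<open>Q\<close> that are equal
      to each other and each closer than this to \<open>P x\<close> and \<open>Q x\<close> give the
      contradiction.\<close>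
    then have e: "0 < \<bar>P x - Q x\<bar> / 2" by simp
    obtain d1 where d1: "d1 > 0" "\<And>y. dist y x < d1 \<Longrightarrow> dist (P y) (P x) < \<bar>P x - Q x\<bar> / 2"
      using cont(1) e unfolding continuous_at_eps_delta by blast
    obtain d2 where d2: "d2 > 0" "\<And>y. dist y x < d2 \<Longrightarrow> dist (Q y) (Q x) < \<bar>P x - Q x\<bar> / 2"
      using cont(2) e unfolding continuous_at_eps_delta by blast
    obtain d3 where d3: "d3 > 0" "ball x d3 \<subseteq> S"
      using assms(1,3) open_contains_ball by blast
    define d where "d = min d1 (min d2 d3)"
    have d: "d > 0" using d1 d2 d3 by (simp add: d_def)
    \<comment> \<open>Chosen so that the whole parallelogram with
      \<open>\<bar>s\<bar> \<le> h\<close> and \<open>\<bar>t\<bar> \<le> h\<close> lies within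
      \<open>d\<close> of \<open>x\<close>. The summand 1 avoids division by zero for
      \<open>v = w = 0\<close> and makes the estimate strict.\<close>
    define h where "h = d / (norm v + norm w + 1)"
    have pos: "0 < norm v + norm w + 1" by (simp add: add_nonneg_pos)
    then have h: "0 < h" using d by (simp add: h_def)
    have near: "dist (x + s *\<^sub>R v + t *\<^sub>R w) x < d" if "\<bar>s\<bar> \<le> h" "\<bar>t\<bar> \<le> h" for s t
    proof -
      have "dist (x + s *\<^sub>R v + t *\<^sub>R w) x = norm (s *\<^sub>R v + t *\<^sub>R w)"
        by (simp add: dist_norm algebra_simps)
      also have "\<dots> \<le> \<bar>s\<bar> * norm v + \<bar>t\<bar> * norm w"
        by (metis norm_scaleR norm_triangle_ineq)
      also have "\<dots> \<le> h * norm v + h * norm w"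
        using that by (intro add_mono mult_right_mono) auto
      also have "\<dots> < h * (norm v + norm w + 1)"
        using h by (simp add: algebra_simps)
      also have "\<dots> = d" using pos by (simp add: h_def)
      finally show ?thesis .
    qed
    have inS: "x + s *\<^sub>R v + t *\<^sub>R w \<in> S" if "\<bar>s\<bar> \<le> h" "\<bar>t\<bar> \<le> h" for s t
      using near[OF that] d3 by (auto simp: d_def dist_commute)
    obtain s t where st: "\<bar>s\<bar> \<le> h" "\<bar>t\<bar> \<le> h"
      "g (x + h *\<^sub>R v + h *\<^sub>R w) - g (x + h *\<^sub>R v) - g (x + h *\<^sub>R w) + g x =
        h * h * P (x + s *\<^sub>R v + t *\<^sub>R w)"
      using second_difference_eq[OF assms(2) h inS] unfolding P_def by blast
    have inS': "x + s *\<^sub>R w + t *\<^sub>R v \<in> S" if "\<bar>s\<bar> \<le> h" "\<bar>t\<bar> \<le> h" for s t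
      using inS[OF that(2,1)] by (simp add: algebra_simps)
    obtain s' t' where st': "\<bar>s'\<bar> \<le> h" "\<bar>t'\<bar> \<le> h"
      "g (x + h *\<^sub>R w + h *\<^sub>R v) - g (x + h *\<^sub>R w) - g (x + h *\<^sub>R v) + g x =
        h * h * Q (x + s' *\<^sub>R w + t' *\<^sub>R v)"
      using second_difference_eq[OF assms(2) h inS'] unfolding Q_def by blast
    have "h * h * P (x + s *\<^sub>R v + t *\<^sub>R w) = h * h * Q (x + t' *\<^sub>R v + s' *\<^sub>R w)"
      using st(3) st'(3) by (simp add: algebra_simps)
    then have "P (x + s *\<^sub>R v + t *\<^sub>R w) = Q (x + t' *\<^sub>R v + s' *\<^sub>R w)"
      using h by simp
    moreover have "dist (P (x + s *\<^sub>R v + t *\<^sub>R w)) (P x) < \<bar>P x - Q x\<bar> / 2"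
      using d1(2) near[OF st(1,2)] by (simp add: d_def)
    moreover have "dist (Q (x + t' *\<^sub>R v + s' *\<^sub>R w)) (Q x) < \<bar>P x - Q x\<bar> / 2"
      using d2(2) near[OF st'(2,1)] by (simp add: d_def)
    ultimately show False
      by (simp add: dist_real_def) argo
  qed
  then show ?thesis by (simp add: P_def Q_def)
qed

text \<open>The mean value theorem is about real functions, so the claim is tested on the inner
  products with every vector \<open>z\<close>. It is applied to coordinate changes, whose values lie
  in the model space.\<close>

lemma symmetric_second_derivative:
  fixes f :: "'e::real_normed_vector \<Rightarrow> 'f::real_inner"
  assumes "open S" "smooth_on S f" "x \<in> S"
  shows "frechet_derivative (\<lambda>y. frechet_derivative f (at y) v) (at x) w =
    frechet_derivative (\<lambda>y. frechet_derivative f (at y) w) (at x) v"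
proof (rule vector_eq_ldot[THEN iffD1, rule_format])
  fix z
  have D: "frechet_derivative (\<lambda>y. f y \<bullet> z) (at y) u = frechet_derivative f (at y) u \<bullet> z"
    if "smooth_on S f" "y \<in> S" for y u and f :: "'e \<Rightarrow> 'f"
    using frechet_derivative_at[OF has_derivative_inner_left[OF smooth_on_has_derivative[OF that]]]
    by metis
  \<comment> \<open>The outer derivative sees the inner one as a function near \<open>x\<close>, so
    \<open>D\<close> is used at all points of the open set \<open>S\<close> before it is used at
    \<open>x\<close>.\<close>
  have DD: "frechet_derivative (\<lambda>y. frechet_derivative (\<lambda>y. f y \<bullet> z) (at y) u) (at x) u' =
      frechet_derivative (\<lambda>y. frechet_derivative f (at y) u) (at x) u' \<bullet> z" for u u'
  proof -
    have "smooth_on S (\<lambda>y. frechet_derivative (\<lambda>y. f y \<bullet> z) (at y) u)"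
      using assms by (intro smooth_on_frechet_derivative smooth_on_inner_left)
    then have "frechet_derivative (\<lambda>y. frechet_derivative (\<lambda>y. f y \<bullet> z) (at y) u) (at x) =
        frechet_derivative (\<lambda>y. frechet_derivative f (at y) u \<bullet> z) (at x)"
      using assms D by (intro frechet_derivative_transform_within_open[of _ _ S] smooth_on_differentiable) auto
    then show ?thesis
      using D[OF smooth_on_frechet_derivative[OF assms(2)] assms(3)] by simp
  qed
  show "z \<bullet> frechet_derivative (\<lambda>y. frechet_derivative f (at y) v) (at x) w =
    z \<bullet> frechet_derivative (\<lambda>y. frechet_derivative f (at y) w) (at x) v"
    using symmetric_second_derivative_real[OF assms(1) smooth_on_inner_left[OF assms(1,2)] assms(3), of z v w]
    by (simp only: DD inner_commute[of z])
qed


section \<open>Alternating multilinear maps\<close>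

text \<open>Multilinearity without a fixed degree: lists of every length are allowed, which is
  harmless because forms vanish on lists of the wrong length. The property survives fixing the first
  argument, as inductions along the argument list require.\<close>

definition slotwise_linear :: "('e::real_vector list \<Rightarrow> complex) \<Rightarrow> bool" where
  "slotwise_linear f \<longleftrightarrow> (\<forall>us ws. linear (\<lambda>v. f (us @ v # ws)))"

definition slot_antisymmetric :: "('e list \<Rightarrow> complex) \<Rightarrow> bool" where
  "slot_antisymmetric f \<longleftrightarrow> (\<forall>us a b ws. f (us @ a # b # ws) = - f (us @ b # a # ws))"

lemma slotwise_linearD: "slotwise_linear f \<Longrightarrow> linear (\<lambda>v. f (us @ v # ws))"
  by (simp add: slotwise_linear_def)

lemma slotwise_linear_Cons: "slotwise_linear f \<Longrightarrow> slotwise_linear (\<lambda>ws. f (u # ws))"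
  using slotwise_linearD[of f "u # _"] by (simp add: slotwise_linear_def)

lemma slotwise_linear_hd: "slotwise_linear f \<Longrightarrow> linear (\<lambda>v. f (v # ws))"
  using slotwise_linearD[of f "[]"] by simp

lemma slotwise_linear_add:
  "slotwise_linear f \<Longrightarrow> slotwise_linear g \<Longrightarrow> slotwise_linear (\<lambda>vs. f vs + g vs)"
  by (simp add: slotwise_linear_def linear_compose_add)

lemma slotwise_linear_scale: "slotwise_linear f \<Longrightarrow> slotwise_linear (\<lambda>vs. a * f vs)"
  by (auto simp: slotwise_linear_def linear_iff algebra_simps)

lemma slot_antisymmetricI:
  "(\<And>us a b ws. f (us @ a # b # ws) = - f (us @ b # a # ws)) \<Longrightarrow> slot_antisymmetric f"
  unfolding slot_antisymmetric_def by blast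

lemma slot_antisymmetricD:
  "slot_antisymmetric f \<Longrightarrow> f (us @ a # b # ws) = - f (us @ b # a # ws)"
  unfolding slot_antisymmetric_def by blast

lemma slot_antisymmetric_Cons:
  assumes "slot_antisymmetric f"
  shows "slot_antisymmetric (\<lambda>ws. f (u # ws))"
proof (rule slot_antisymmetricI)
  fix us a b ws
  show "f (u # us @ a # b # ws) = - f (u # us @ b # a # ws)"
    using slot_antisymmetricD[OF assms, of "u # us" a b ws] by simp
qed

text \<open>Moving \<open>h\<close> past \<open>vs\<close> takes one adjacent transposition for each
  entry of \<open>vs\<close>.\<close>

lemma slot_antisymmetric_move:
  assumes "slot_antisymmetric f"
  shows "f (us @ h # vs @ ws) = (-1) ^ length vs * f (us @ vs @ h # ws)"
proof (induction vs arbitrary: us)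
  case (Cons v vs)
  have "f (us @ h # v # vs @ ws) = - f (us @ v # h # vs @ ws)"
    by (rule slot_antisymmetricD[OF assms])
  then show ?case
    using Cons[of "us @ [v]"] by simp
qed simp

lemma alternating_multilinear_length:
  "alternating_multilinear k f \<Longrightarrow> length vs \<noteq> k \<Longrightarrow> f vs = 0"
  by (simp add: alternating_multilinear_def)

lemma alternating_multilinear_slotwise_linear:
  assumes "alternating_multilinear k f"
  shows "slotwise_linear f"
  unfolding slotwise_linear_def
proof (intro allI)
  fix us ws
  show "linear (\<lambda>v. f (us @ v # ws))"
  proof (cases "length (us @ 0 # ws) = k")
    case True
    \<comment> \<open>The entry \<open>0\<close> is only a placeholder, overwritten by the list
      update.\<close>
    then have "linear (\<lambda>v. f ((us @ 0 # ws)[length us := v]))"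
      using assms unfolding alternating_multilinear_def by (metis add_Suc_right
          length_append length_Cons less_add_Suc1)
    then show ?thesis by simp
  next
    case False
    then have "(\<lambda>v. f (us @ v # ws)) = (\<lambda>v. 0)"
      using alternating_multilinear_length[OF assms] by fastforce
    then show ?thesis by (simp add: linear_zero)
  qed
qed

lemma alternating_multilinear_repeat:
  assumes "alternating_multilinear k f"
  shows "f (us @ v # vs @ v # ws) = 0"
proof (cases "length (us @ v # vs @ v # ws) = k")
  case True
  then show ?thesis
    using assms unfolding alternating_multilinear_def
    by (elim conjE allE[of _ "us @ v # vs @ v # ws"] allE[of _ "length us"]
        allE[of _ "length us + Suc (length vs)"]) (simp add: nth_append)
qed (use alternating_multilinear_length[OF assms] in blast)

text \<open>Polarisation: expand the vanishing value with \<open>a + b\<close> in both neighbouring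
  slots.\<close>

lemma alternating_multilinear_slot_antisymmetric:
  assumes "alternating_multilinear k f"
  shows "slot_antisymmetric f"
  unfolding slot_antisymmetric_def
proof (intro allI)
  fix us a b ws
  note sl = alternating_multilinear_slotwise_linear[OF assms]
  have 1: "f (us @ (a + b) # v # ws) = f (us @ a # v # ws) + f (us @ b # v # ws)" for v
    using linear_add[OF slotwise_linearD[OF sl, of us "v # ws"]] by simp
  have 2: "f (us @ v # (a + b) # ws) = f (us @ v # a # ws) + f (us @ v # b # ws)" for v
    using linear_add[OF slotwise_linearD[OF sl, of "us @ [v]" ws]] by simp
  have 3: "f (us @ v # v # ws) = 0" for v
    using alternating_multilinear_repeat[OF assms, of us v "[]"] by simp
  have "f (us @ (a + b) # (a + b) # ws) = f (us @ a # b # ws) + f (us @ b # a # ws)"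
    by (simp only: 1 2) (simp add: 3)
  moreover have "f (us @ (a + b) # (a + b) # ws) = 0" by (rule 3)
  ultimately show "f (us @ a # b # ws) = - f (us @ b # a # ws)"
    by (simp add: eq_neg_iff_add_eq_0)
qed

lemma alternating_multilinearI:
  assumes "\<And>vs. length vs \<noteq> k \<Longrightarrow> f vs = 0"
    and "slotwise_linear f"
    and "\<And>us v vs ws. length (us @ v # vs @ v # ws) = k \<Longrightarrow> f (us @ v # vs @ v # ws) = 0"
  shows "alternating_multilinear k f"
  unfolding alternating_multilinear_def
proof (intro conjI allI impI; (elim conjE)?)
  fix vs :: "'a list" and i assume "length vs = k" "i < k"
  then show "linear (\<lambda>v. f (vs[i := v]))"
    using assms(2) by (simp add: upd_conv_take_nth_drop slotwise_linearD)
next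
  fix vs :: "'a list" and i j
  assume k: "length vs = k" and ij: "i < j" "j < k" "vs ! i = vs ! j"
  \<comment> \<open>The entries strictly between the two equal ones, so that \<open>vs\<close> takes
    the form required by the third assumption.\<close>
  define ms where "ms = take (j - Suc i) (drop (Suc i) vs)"
  have "vs = take i vs @ vs ! i # drop (Suc i) vs"
    using ij k by (intro id_take_nth_drop) simp
  moreover have "drop (Suc i) vs = ms @ vs ! j # drop (Suc j) vs"
    using ij k id_take_nth_drop[of "j - Suc i" "drop (Suc i) vs"] by (simp add: ms_def)
  ultimately have "vs = take i vs @ vs ! i # ms @ vs ! i # drop (Suc j) vs"
    using ij by simp
  then show "f vs = 0" using assms(3) k by metis
qed (use assms(1) in blast)

lemma alternating_multilinear_zero: "alternating_multilinear k (\<lambda>vs. 0)"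
  by (simp add: alternating_multilinear_def linear_zero)

lemma alternating_multilinear_add:
  "alternating_multilinear k f \<Longrightarrow> alternating_multilinear k g \<Longrightarrow>
    alternating_multilinear k (\<lambda>vs. f vs + g vs)"
  by (simp add: alternating_multilinear_def linear_compose_add)

lemma alternating_multilinear_scale:
  "alternating_multilinear k f \<Longrightarrow> alternating_multilinear k (\<lambda>vs. a * f vs)"
  by (auto simp: alternating_multilinear_def linear_iff algebra_simps)

lemma alternating_multilinear_map:
  assumes f: "alternating_multilinear k f" and L: "linear L"
  shows "alternating_multilinear k (\<lambda>vs. f (map L vs))"
proof (rule alternating_multilinearI)
  show "slotwise_linear (\<lambda>vs. f (map L vs))"
    unfolding slotwise_linear_def
    using linear_compose[OF L slotwise_linearD[OF alternating_multilinear_slotwise_linear[OF f]]]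
    by (simp add: o_def)
qed (use alternating_multilinear_length[OF f] alternating_multilinear_repeat[OF f] in auto)

lemma slotwise_linear_map_scaleR:
  assumes "slotwise_linear f"
  shows "f (us @ map (\<lambda>v. c *\<^sub>R v) vs) = c ^ length vs *\<^sub>R f (us @ vs)"
proof (induction vs arbitrary: us)
  case (Cons v vs)
  show ?case
    using Cons[of "us @ [c *\<^sub>R v]"] linear_scale[OF slotwise_linearD[OF assms, of us vs], of c v]
    by simp
qed simp

text \<open>Replaces \<open>Basis\<close>, which the model space lacks: it is not assumed to be of class
  \<open>euclidean_space\<close>.\<close>

lemma dual_basis_exists:
  fixes Bs :: "'e::real_inner set"
  assumes "finite Bs" "span Bs = UNIV"
  obtains E :: "'e set" and co :: "'e \<Rightarrow> 'e"
  where "finite E" "\<And>v. v = (\<Sum>b\<in>E. (v \<bullet> co b) *\<^sub>R b)"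
proof -
  obtain E where E: "finite E" "span E = (UNIV :: 'e set)" "pairwise orthogonal E"
    using basis_orthogonal[OF assms(1)] assms(2) by auto
  have "v = (\<Sum>b\<in>E. (v \<bullet> (b /\<^sub>R (b \<bullet> b))) *\<^sub>R b)" for v
  proof -
    have "v \<in> span E" using E by simp
    then obtain u where u: "v = (\<Sum>a\<in>E. u a *\<^sub>R a)"
      unfolding span_finite[OF E(1)] by auto
    have "v \<bullet> b = u b * (b \<bullet> b)" if "b \<in> E" for b
    proof -
      have "v \<bullet> b = (\<Sum>a\<in>E. u a * (a \<bullet> b))"
        by (simp add: u inner_sum_left)
      also have "\<dots> = (\<Sum>a\<in>E. if a = b then u b * (b \<bullet> b) else 0)"
        using E(3) that by (intro sum.cong) (auto simp: pairwise_def orthogonal_def)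
      finally show ?thesis using that E(1) by simp
    qed
    \<comment> \<open>The orthogonal family \<open>E\<close> need not be normalised and may contain
      0. For \<open>b = 0\<close> both sides vanish, so the division by \<open>b \<bullet> b\<close>
      does no harm.\<close>
    then have "(v \<bullet> (b /\<^sub>R (b \<bullet> b))) *\<^sub>R b = u b *\<^sub>R b" if "b \<in> E" for b
      using that by (cases "b = 0") auto
    then have "(\<Sum>b\<in>E. (v \<bullet> (b /\<^sub>R (b \<bullet> b))) *\<^sub>R b) = (\<Sum>b\<in>E. u b *\<^sub>R b)"
      by (intro sum.cong refl)
    then show ?thesis using u by metis
  qed
  then show ?thesis by (rule that[OF E(1)])
qed


section \<open>Complex multilinear extension and types\<close>

lemma complexify_add: "complexify (\<lambda>vs. f vs + g vs) zs = complexify f zs + complexify g zs"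
  by (induction zs arbitrary: f g) (auto simp: algebra_simps)

lemma complexify_scale: "complexify (\<lambda>vs. a * f vs) zs = a * complexify f zs"
  by (induction zs arbitrary: f) (auto simp: algebra_simps)

lemma complexify_uminus: "complexify (\<lambda>vs. - f vs) zs = - complexify f zs"
  using complexify_scale[of "-1" f] by simp

lemma complexify_zero: "complexify (\<lambda>vs. 0) zs = 0"
  using complexify_scale[of 0 "\<lambda>_. 0"] by simp

lemma complexify_sum: "complexify (\<lambda>vs. \<Sum>i\<in>I. f i vs) zs = (\<Sum>i\<in>I. complexify (f i) zs)"
  by (induction I rule: infinite_finite_induct) (auto simp: complexify_add complexify_zero)

lemma complexify_swap:
  assumes "slot_antisymmetric f"
  shows "complexify f (z # z' # zs) = - complexify f (z' # z # zs)"
proof -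
  obtain u v u' v' where z: "z = (u, v)" "z' = (u', v')" by fastforce
  have 1: "complexify (\<lambda>ws. f (a # b # ws)) zs = - complexify (\<lambda>ws. f (b # a # ws)) zs" for a b
  proof -
    have "(\<lambda>ws. f (a # b # ws)) = (\<lambda>ws. - f (b # a # ws))"
      using slot_antisymmetricD[OF assms, of "[]" a b] by auto
    then show ?thesis by (simp only: complexify_uminus)
  qed
  show ?thesis
    by (simp add: z 1[of u u'] 1[of u v'] 1[of v u'] 1[of v v'] algebra_simps)
qed

lemma complexify_move:
  assumes "slot_antisymmetric f"
  shows "complexify f (z # zs @ ws) = (-1) ^ length zs * complexify f (zs @ z # ws)"
  using assms
proof (induction zs arbitrary: f)
  case (Cons y zs)
  obtain u v where y: "y = (u, v)" by fastforce
  have "complexify f (z # y # zs @ ws) = - complexify f (y # z # zs @ ws)"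
    using complexify_swap[OF Cons.prems] .
  then show ?case
    using Cons.IH[OF slot_antisymmetric_Cons[OF Cons.prems]] by (simp add: y algebra_simps)
qed simp

text \<open>Insertion sort. \<open>Apq\<close> tests forms only on lists with the (1,0) vectors in
  front, so arbitrary lists of typed vectors must be brought to that order. The factor
  \<open>s\<close> must not depend on \<open>f\<close>: the induction step uses it for the real and
  the imaginary part of the first argument at once.\<close>

lemma complexify_sort:
  assumes "set xs \<subseteq> P \<union> Q"
  shows "\<exists>zs ws s. set zs \<subseteq> P \<and> set ws \<subseteq> Q \<and> length zs + length ws = length xs \<and>
    (\<forall>f. slot_antisymmetric f \<longrightarrow> complexify f xs = s * complexify f (zs @ ws))"
  using assms
proof (induction xs)
  case Nil
  show ?case by (intro exI[of _ "[]"] exI[of _ 1]) simp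
next
  case (Cons x xs)
  then obtain zs ws s where IH: "set zs \<subseteq> P" "set ws \<subseteq> Q" "length zs + length ws = length xs"
    "\<And>f. slot_antisymmetric f \<Longrightarrow> complexify f xs = s * complexify f (zs @ ws)"
    by auto
  obtain u v where x: "x = (u, v)" by fastforce
  have 1: "complexify f (x # xs) = s * complexify f (x # zs @ ws)" if "slot_antisymmetric f" for f
    using IH(4)[OF slot_antisymmetric_Cons[OF that]] by (simp add: x algebra_simps)
  show ?case
  proof (cases "x \<in> P")
    case True
    with 1 IH show ?thesis by (intro exI[of _ "x # zs"] exI[of _ ws] exI[of _ s]) auto
  next
    case False
    with 1 IH Cons.prems complexify_move[of _ x zs ws] show ?thesis
      by (intro exI[of _ zs] exI[of _ "x # ws"] exI[of _ "s * (-1) ^ length zs"]) auto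
  qed
qed

text \<open>Typed vectors span the complexified tangent space: u + i Ju is of type (0,1), Ju + i u
  is of type (1,0), and 2u = (u + i Ju) - i (Ju + i u). The induction replaces one real argument at
  a time, its hypothesis being applied to \<open>f\<close> with a typed vector put into the first
  slot.\<close>

lemma slotwise_linear_eq_0:
  assumes JJ: "\<And>v. Jx (Jx v) = - v"
  shows "slotwise_linear f \<Longrightarrow>
    (\<And>xs. set xs \<subseteq> T10 Jx \<union> T01 Jx \<Longrightarrow> length xs = length vs \<Longrightarrow> complexify f xs = 0) \<Longrightarrow> f vs = 0"
proof (induction vs arbitrary: f)
  case Nil
  then show ?case using Nil(2)[of "[]"] by simp
next
  case (Cons u vs)
  have 0: "f (a # vs) + \<i> * f (b # vs) = 0" if "(a, b) \<in> T10 Jx \<union> T01 Jx" for a b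
  proof (rule Cons.IH)
    show "slotwise_linear (\<lambda>vs. f (a # vs) + \<i> * f (b # vs))"
      using Cons.prems(1) by (intro slotwise_linear_add slotwise_linear_scale slotwise_linear_Cons)
    fix xs assume "set xs \<subseteq> T10 Jx \<union> T01 Jx" "length xs = length vs"
    then show "complexify (\<lambda>vs. f (a # vs) + \<i> * f (b # vs)) xs = 0"
      using Cons.prems(2)[of "(a, b) # xs"] that by (simp add: complexify_add complexify_scale)
  qed
  have "(u, Jx u) \<in> T01 Jx" using JJ by (simp add: T01_def)
  moreover have "(Jx u, u) \<in> T10 Jx" using JJ by (simp add: T10_def)
  ultimately have "f (u # vs) + \<i> * f (Jx u # vs) = 0" "f (Jx u # vs) + \<i> * f (u # vs) = 0"
    using 0 by blast+
  then have "f (u # vs) + \<i> * f (Jx u # vs) - \<i> * (f (Jx u # vs) + \<i> * f (u # vs)) = 0"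
    by simp
  then show ?case by (simp add: algebra_simps)
qed

text \<open>This turns identities between forms into identities on sorted lists of typed vectors,
  where the type conditions give information.\<close>

lemma alternating_multilinear_eq_0:
  assumes JJ: "\<And>v. Jx (Jx v) = - v"
    and f: "alternating_multilinear k f"
    and 0: "\<And>zs ws. set zs \<subseteq> T10 Jx \<Longrightarrow> set ws \<subseteq> T01 Jx \<Longrightarrow> length zs + length ws = k \<Longrightarrow>
      complexify f (zs @ ws) = 0"
  shows "f vs = 0"
proof (cases "length vs = k")
  case True
  show ?thesis
  proof (rule slotwise_linear_eq_0[OF JJ alternating_multilinear_slotwise_linear[OF f]])
    fix xs assume "set xs \<subseteq> T10 Jx \<union> T01 Jx" "length xs = length vs"
    then show "complexify f xs = 0"
      using complexify_sort[of xs "T10 Jx" "T01 Jx"] 0 True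
        alternating_multilinear_slot_antisymmetric[OF f] by fastforce
  qed
qed (use alternating_multilinear_length[OF f] in blast)

text \<open>On (1,0) vectors J is multiplication by i and on (0,1) vectors by -i, so a + bJ
  multiplies them by a + ib and a - ib. The case \<open>a = 0\<close>, \<open>b = 1\<close> is J
  itself; a cosine and a sine give the rotations used for the type projections.\<close>

lemma complexify_rotate:
  assumes "slotwise_linear f" "set zs \<subseteq> T10 Jx" "set ws \<subseteq> T01 Jx"
  shows "complexify (\<lambda>vs. f (map (\<lambda>v. a *\<^sub>R v + b *\<^sub>R Jx v) vs)) (zs @ ws) =
    Complex a b ^ length zs * Complex a (- b) ^ length ws * complexify f (zs @ ws)"
proof -
  let ?K = "\<lambda>v. a *\<^sub>R v + b *\<^sub>R Jx v"
  \<comment> \<open>One slot at a time. Taking \<open>b' = b\<close> for a (1,0) vector and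
    \<open>b' = - b\<close> for a (0,1) vector lets one computation serve both types.\<close>
  have head: "complexify (\<lambda>vs. f (?K u # map ?K vs)) xs + \<i> * complexify (\<lambda>vs. f (?K v # map ?K vs)) xs =
      Complex a b' * (complexify (\<lambda>vs. f (u # map ?K vs)) xs + \<i> * complexify (\<lambda>vs. f (v # map ?K vs)) xs)"
    if f: "slotwise_linear f" and K: "?K u = a *\<^sub>R u - b' *\<^sub>R v" "?K v = a *\<^sub>R v + b' *\<^sub>R u"
    for f u v b' xs
  proof -
    have "f (?K u # vs) = a * f (u # vs) + (- b') * f (v # vs)"
      and "f (?K v # vs) = a * f (v # vs) + b' * f (u # vs)" for vs
      unfolding K using slotwise_linear_hd[OF f, of vs]
      by (simp_all add: linear_add[OF slotwise_linear_hd[OF f]] linear_diff[OF slotwise_linear_hd[OF f]]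
          linear_scale[OF slotwise_linear_hd[OF f]] scaleR_conv_of_real)
    then have "complexify (\<lambda>vs. f (?K u # map ?K vs)) xs =
        complexify (\<lambda>vs. a * f (u # map ?K vs) + (- b') * f (v # map ?K vs)) xs"
      and "complexify (\<lambda>vs. f (?K v # map ?K vs)) xs =
        complexify (\<lambda>vs. a * f (v # map ?K vs) + b' * f (u # map ?K vs)) xs"
      by presburger+
    then show ?thesis
      unfolding complexify_add complexify_scale Complex_eq
      by (simp add: algebra_simps)
  qed
  show ?thesis
    using assms
  proof (induction zs arbitrary: f)
    case Nil
    then show ?case
    proof (induction ws arbitrary: f)
      case (Cons w ws)
      obtain u v where w: "w = (u, v)" by fastforce
      then have "Jx u = v" "Jx v = - u" using Cons.prems by (auto simp: T01_def)
      then have "?K u = a *\<^sub>R u - (- b) *\<^sub>R v" "?K v = a *\<^sub>R v + (- b) *\<^sub>R u" by simp_all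
      note head[OF Cons.prems(1) this, of "ws"]
      then have "complexify (\<lambda>vs. f (map ?K vs)) (w # ws) = Complex a (- b) *
          (complexify (\<lambda>vs. f (u # map ?K vs)) ws + \<i> * complexify (\<lambda>vs. f (v # map ?K vs)) ws)"
        by (simp only: w complexify.simps list.map)
      then show ?case
        using Cons.IH[OF slotwise_linear_Cons[OF Cons.prems(1), of u]]
          Cons.IH[OF slotwise_linear_Cons[OF Cons.prems(1), of v]] Cons.prems
        by (simp add: w algebra_simps)
    qed simp
  next
    case (Cons z zs)
    obtain u v where z: "z = (u, v)" by fastforce
    then have "Jx u = - v" "Jx v = u" using Cons.prems by (auto simp: T10_def)
    then have "?K u = a *\<^sub>R u - b *\<^sub>R v" "?K v = a *\<^sub>R v + b *\<^sub>R u" by simp_all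
    note head[OF Cons.prems(1) this, of "zs @ ws"]
    then have "complexify (\<lambda>vs. f (map ?K vs)) ((z # zs) @ ws) = Complex a b *
        (complexify (\<lambda>vs. f (u # map ?K vs)) (zs @ ws) + \<i> * complexify (\<lambda>vs. f (v # map ?K vs)) (zs @ ws))"
      by (simp only: z append_Cons complexify.simps list.map)
    then show ?case
      using Cons.IH[OF slotwise_linear_Cons[OF Cons.prems(1), of u]]
        Cons.IH[OF slotwise_linear_Cons[OF Cons.prems(1), of v]] Cons.prems
      by (simp add: z algebra_simps)
  qed
qed


section \<open>Differential forms on a manifold\<close>

lemma linear_dual_basis:
  fixes g :: "'e::real_inner \<Rightarrow> 'f::real_vector"
  assumes "\<And>v. v = (\<Sum>b\<in>E. (v \<bullet> co b) *\<^sub>R b)" "linear g"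
  shows "g v = (\<Sum>b\<in>E. (v \<bullet> co b) *\<^sub>R g b)"
proof -
  have "g v = g (\<Sum>b\<in>E. (v \<bullet> co b) *\<^sub>R b)" using assms(1) by metis
  then show ?thesis using assms(2) by (simp add: linear_sum linear_scale)
qed

lemma frechet_derivative_add:
  assumes "f differentiable (at x)" "g differentiable (at x)"
  shows "frechet_derivative (\<lambda>y. f y + g y) (at x) v =
    frechet_derivative f (at x) v + frechet_derivative g (at x) v"
  using assms unfolding frechet_derivative_works
  by (metis frechet_derivative_at has_derivative_add)

lemma frechet_derivative_scaleR:
  assumes "f differentiable (at x)"
  shows "frechet_derivative (\<lambda>y. a *\<^sub>R f y) (at x) v = a *\<^sub>R frechet_derivative f (at x) v"
  using assms unfolding frechet_derivative_works
  by (metis frechet_derivative_at has_derivative_scaleR_right)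

lemma frechet_derivative_mult:
  fixes f :: "'a::real_normed_vector \<Rightarrow> 'b::real_normed_algebra"
  assumes "f differentiable (at x)"
  shows "frechet_derivative (\<lambda>y. a * f y) (at x) v = a * frechet_derivative f (at x) v"
  using assms unfolding frechet_derivative_works
  by (metis frechet_derivative_at has_derivative_mult_right)

lemma frechet_derivative_sum:
  assumes "\<And>i. i \<in> I \<Longrightarrow> f i differentiable (at x)"
  shows "frechet_derivative (\<lambda>y. \<Sum>i\<in>I. f i y) (at x) v = (\<Sum>i\<in>I. frechet_derivative (f i) (at x) v)"
proof -
  have "((\<lambda>y. \<Sum>i\<in>I. f i y) has_derivative (\<lambda>v. \<Sum>i\<in>I. frechet_derivative (f i) (at x) v)) (at x)"
    using assms by (intro has_derivative_sum) (simp add: frechet_derivative_works)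
  from frechet_derivative_at[OF this] show ?thesis by metis
qed

text \<open>Expanding the varying argument \<open>K x v\<close> in the finite family
  \<open>E\<close> leaves smooth coefficients times values on fixed vectors. The prefix
  \<open>us\<close> collects the slots that are already fixed.\<close>

lemma smooth_on_multilinear_map:
  fixes K :: "'e::real_inner \<Rightarrow> 'e \<Rightarrow> 'e"
  assumes basis: "\<And>v::'e. v = (\<Sum>b\<in>E. (v \<bullet> co b) *\<^sub>R b)"
    and S: "open S" and f: "\<And>x. x \<in> S \<Longrightarrow> slotwise_linear (f x)" "\<And>vs. smooth_on S (\<lambda>x. f x vs)"
    and K: "\<And>v. smooth_on S (\<lambda>x. K x v)"
  shows "smooth_on S (\<lambda>x. f x (us @ map (K x) vs))"
proof (induction vs arbitrary: us)
  case (Cons v vs)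
  have "f x (us @ map (K x) (v # vs)) = (\<Sum>b\<in>E. (K x v \<bullet> co b) *\<^sub>R f x ((us @ [b]) @ map (K x) vs))"
    if "x \<in> S" for x
    using linear_dual_basis[OF basis slotwise_linearD[OF f(1)[OF that]], of us "K x v"] by simp
  moreover have "smooth_on S (\<lambda>x. \<Sum>b\<in>E. (K x v \<bullet> co b) *\<^sub>R f x ((us @ [b]) @ map (K x) vs))"
    using S K Cons.IH by (intro smooth_on_sum smooth_on_scaleR smooth_on_inner_left)
  ultimately show ?case
    using smooth_on_cong[OF S] by (metis (mono_tags, lifting))
qed (use f in simp)

text \<open>The product rule for a multilinear map whose base point and arguments both vary: one
  term for the base point and one for each slot. It is applied with a coordinate change as
  \<open>\<tau>\<close> and its derivative as \<open>K\<close>, so the slot terms carry second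
  derivatives.\<close>

lemma has_derivative_multilinear_map:
  fixes f :: "'e::real_inner \<Rightarrow> 'e list \<Rightarrow> complex" and \<tau> :: "'x::real_normed_vector \<Rightarrow> 'e"
    and K :: "'x \<Rightarrow> 'w \<Rightarrow> 'e"
  assumes basis: "\<And>v::'e. v = (\<Sum>b\<in>E. (v \<bullet> co b) *\<^sub>R b)"
    and f: "\<And>z. slotwise_linear (f z)" "\<And>vs. (\<lambda>z. f z vs) differentiable (at (\<tau> x))"
    and \<tau>: "(\<tau> has_derivative T) (at x)" and K: "\<And>w. (\<lambda>y. K y w) differentiable (at x)"
  shows "((\<lambda>y. f (\<tau> y) (us @ map (K y) ws)) has_derivative
    (\<lambda>v. frechet_derivative (\<lambda>z. f z (us @ map (K x) ws)) (at (\<tau> x)) (T v) +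
      (\<Sum>j<length ws. f (\<tau> x) (us @ take j (map (K x) ws) @
        frechet_derivative (\<lambda>y. K y (ws ! j)) (at x) v # drop (Suc j) (map (K x) ws))))) (at x)"
proof (induction ws arbitrary: us)
  case Nil
  have "((\<lambda>z. f z us) has_derivative frechet_derivative (\<lambda>z. f z us) (at (\<tau> x))) (at (\<tau> x))"
    using f(2) frechet_derivative_works by blast
  from has_derivative_compose[OF \<tau> this] show ?case by simp
next
  case (Cons w ws)
  let ?Dw = "frechet_derivative (\<lambda>y. K y w) (at x)"
  let ?D = "\<lambda>us v. frechet_derivative (\<lambda>z. f z (us @ map (K x) ws)) (at (\<tau> x)) (T v)"
  let ?F = "\<lambda>us v j. f (\<tau> x) (us @ take j (map (K x) ws) @
        frechet_derivative (\<lambda>y. K y (ws ! j)) (at x) v # drop (Suc j) (map (K x) ws))"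
  have ex: "f z (us @ u # r) = (\<Sum>b\<in>E. (u \<bullet> co b) *\<^sub>R f z (us @ b # r))" for z u r
    using linear_dual_basis[OF basis slotwise_linearD[OF f(1)]] .
  have "((\<lambda>y. K y w) has_derivative ?Dw) (at x)"
    using K frechet_derivative_works by blast
  then have "((\<lambda>y. \<Sum>b\<in>E. (K y w \<bullet> co b) *\<^sub>R f (\<tau> y) ((us @ [b]) @ map (K y) ws)) has_derivative
     (\<lambda>v. \<Sum>b\<in>E. (K x w \<bullet> co b) *\<^sub>R (?D (us @ [b]) v + (\<Sum>j<length ws. ?F (us @ [b]) v j)) +
       (?Dw v \<bullet> co b) *\<^sub>R f (\<tau> x) ((us @ [b]) @ map (K x) ws))) (at x)"
    by (intro has_derivative_sum has_derivative_scaleR has_derivative_inner_left Cons.IH)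
  moreover have "(\<Sum>b\<in>E. (K y w \<bullet> co b) *\<^sub>R f (\<tau> y) ((us @ [b]) @ map (K y) ws)) =
      f (\<tau> y) (us @ map (K y) (w # ws))" for y
    using ex[of "\<tau> y" "K y w" "map (K y) ws"] by simp
  moreover have "(\<Sum>b\<in>E. (K x w \<bullet> co b) *\<^sub>R (?D (us @ [b]) v + (\<Sum>j<length ws. ?F (us @ [b]) v j)) +
       (?Dw v \<bullet> co b) *\<^sub>R f (\<tau> x) ((us @ [b]) @ map (K x) ws)) =
     frechet_derivative (\<lambda>z. f z (us @ map (K x) (w # ws))) (at (\<tau> x)) (T v) +
      (\<Sum>j<length (w # ws). f (\<tau> x) (us @ take j (map (K x) (w # ws)) @
        frechet_derivative (\<lambda>y. K y ((w # ws) ! j)) (at x) v # drop (Suc j) (map (K x) (w # ws))))" for v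
  proof -
    \<comment> \<open>The facts \<open>1\<close> to \<open>4\<close> sum the expansion over
      \<open>E\<close> back up: \<open>1\<close> is the base point term, \<open>3\<close> the
      derivative of the first slot, and \<open>2\<close> with \<open>4\<close> the remaining
      slots.\<close>
    have "(\<Sum>b\<in>E. (K x w \<bullet> co b) *\<^sub>R ?D (us @ [b]) v) =
        frechet_derivative (\<lambda>z. \<Sum>b\<in>E. (K x w \<bullet> co b) *\<^sub>R f z (us @ b # map (K x) ws)) (at (\<tau> x)) (T v)"
      by (subst frechet_derivative_sum) (auto simp: f(2) frechet_derivative_scaleR)
    then have 1: "(\<Sum>b\<in>E. (K x w \<bullet> co b) *\<^sub>R ?D (us @ [b]) v) =
        frechet_derivative (\<lambda>z. f z (us @ map (K x) (w # ws))) (at (\<tau> x)) (T v)"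
      using ex[of _ "K x w" "map (K x) ws"] by simp
    have 2: "(\<Sum>b\<in>E. (K x w \<bullet> co b) *\<^sub>R ?F (us @ [b]) v j) = ?F (us @ [K x w]) v j" for j
      using ex[of "\<tau> x" "K x w"] by simp
    have 3: "(\<Sum>b\<in>E. (?Dw v \<bullet> co b) *\<^sub>R f (\<tau> x) ((us @ [b]) @ map (K x) ws)) =
        f (\<tau> x) (us @ ?Dw v # map (K x) ws)"
      using ex[of "\<tau> x" "?Dw v" "map (K x) ws"] by simp
    have 4: "(\<Sum>b\<in>E. (K x w \<bullet> co b) *\<^sub>R (\<Sum>j<length ws. ?F (us @ [b]) v j)) =
        (\<Sum>j<length ws. ?F (us @ [K x w]) v j)"
      unfolding scaleR_sum_right by (subst sum.swap) (simp only: 2)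
    show ?thesis
      unfolding sum.distrib scaleR_add_right 1 3 4 by (simp add: sum.lessThan_Suc_shift del: sum.lessThan_Suc)
  qed
  ultimately show ?case by simp
qed

text \<open>Cancels the second derivatives of a coordinate change in the exterior derivative: the second
  index runs over a list from which the entry at the first index has been removed, so that
  \<open>(Suc j, i)\<close> and \<open>(i, j)\<close>, \<open>i \<le> j\<close>, refer to the same two entries.\<close>

lemma sum_antisymmetric_eq_0:
  fixes S :: "nat \<Rightarrow> nat \<Rightarrow> 'a::ab_group_add"
  assumes "\<And>i j. i \<le> j \<Longrightarrow> j < n \<Longrightarrow> S (Suc j) i = - S i j"
  shows "(\<Sum>i<Suc n. \<Sum>j<n. S i j) = 0"
  using assms
proof (induction n)
  case (Suc n)
  have "(\<Sum>i<Suc (Suc n). \<Sum>j<Suc n. S i j) =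
      (\<Sum>i<Suc n. \<Sum>j<n. S i j) + (\<Sum>i<Suc n. S i n) + (\<Sum>j<Suc n. S (Suc n) j)"
    by (simp add: sum.distrib algebra_simps)
  \<comment> \<open>The last row cancels the last column: the pair \<open>(Suc n, i)\<close> is
    matched with \<open>(i, n)\<close>.\<close>
  also have "(\<Sum>j<Suc n. S (Suc n) j) = - (\<Sum>i<Suc n. S i n)"
    unfolding sum_negf[symmetric] using Suc.prems by (intro sum.cong) auto
  finally have "(\<Sum>i<Suc (Suc n). \<Sum>j<Suc n. S i j) = (\<Sum>i<Suc n. \<Sum>j<n. S i j)"
    by (simp del: sum.lessThan_Suc)
  also have "\<dots> = 0"
    using Suc.prems by (intro Suc.IH) auto
  finally show ?case .
qed simp

section \<open>Charts and coordinate changes\<close>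

locale smooth_atlas =
  fixes n :: nat and X :: "'a topology" and atlas :: "('a, 'e::real_inner) chart set"
  assumes smooth_manifold: "smooth_manifold n X atlas"
begin

lemma dual_basis:
  obtains E :: "'e set" and co :: "'e \<Rightarrow> 'e" where "\<And>v. v = (\<Sum>b\<in>E. (v \<bullet> co b) *\<^sub>R b)"
proof -
  obtain Bs :: "'e set" where "finite Bs" "span Bs = UNIV"
    using smooth_manifold unfolding smooth_manifold_def by blast
  then show ?thesis by (rule dual_basis_exists) (rule that)
qed

lemma is_chart: "c \<in> atlas \<Longrightarrow> is_chart X c"
  using smooth_manifold by (simp add: smooth_manifold_def)

lemma open_chart_image: "c \<in> atlas \<Longrightarrow> open (chart_image c)"
  using is_chart by (simp add: is_chart_def)

lemma homeomorphic_map_chart: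
  "c \<in> atlas \<Longrightarrow> homeomorphic_map (subtopology X (fst c)) (top_of_set (chart_image c)) (snd c)"
  using is_chart by (simp add: is_chart_def)

lemma openin_chart: "c \<in> atlas \<Longrightarrow> openin X (fst c)"
  using is_chart by (simp add: is_chart_def)

lemma topspace_chart: "c \<in> atlas \<Longrightarrow> topspace (subtopology X (fst c)) = fst c"
  by (intro topspace_subtopology_subset openin_subset openin_chart)

lemma inj_on_chart: "c \<in> atlas \<Longrightarrow> inj_on (snd c) (fst c)"
  using homeomorphic_imp_injective_map[OF homeomorphic_map_chart] topspace_chart by metis

lemma open_overlap:
  assumes "c \<in> atlas" "d \<in> atlas"
  shows "open (overlap c d)"
proof -
  have "openin (subtopology X (fst c)) (fst c \<inter> fst d)"
    using openin_subtopology_Int[OF openin_chart[OF assms(2)], of "fst c"] by (simp add: inf_commute)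
  then have "openin (top_of_set (chart_image c)) (overlap c d)"
    unfolding overlap_def
    using homeomorphic_map_openness_eq[OF homeomorphic_map_chart[OF assms(1)]] by blast
  then show ?thesis
    using openin_open_trans open_chart_image[OF assms(1)] by blast
qed

lemma overlap_subset: "overlap c d \<subseteq> chart_image c"
  by (auto simp: overlap_def chart_image_def)

lemma transition_in:
  assumes "c \<in> atlas" "x \<in> overlap c d"
  shows "transition c d x \<in> chart_image d"
  using assms inj_on_chart[OF assms(1)]
  by (auto simp: overlap_def chart_image_def transition_def)

lemma smooth_transition: "c \<in> atlas \<Longrightarrow> d \<in> atlas \<Longrightarrow> smooth_on (overlap c d) (transition c d)"
  using smooth_manifold by (simp add: smooth_manifold_def)

lemma linear_transition_deriv:
  "c \<in> atlas \<Longrightarrow> d \<in> atlas \<Longrightarrow> x \<in> overlap c d \<Longrightarrow> linear (transition_deriv c d x)"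
  using smooth_transition smooth_on_differentiable linear_frechet_derivative by blast

end

section \<open>Forms in charts, and closure of the spaces of forms under d and under endomorphism
  fields\<close>

lemma A_eq_0: "\<alpha> \<in> A atlas k \<Longrightarrow> c \<notin> atlas \<or> x \<notin> chart_image c \<Longrightarrow> \<alpha> c x vs = 0"
  unfolding A_def by blast

text \<open>Because forms are normalised to zero off the charts, this holds for every
  \<open>c\<close> and \<open>x\<close>, which spares the derived rules their side
  conditions.\<close>

lemma A_alternating:
  assumes "\<alpha> \<in> A atlas k"
  shows "alternating_multilinear k (\<alpha> c x)"
proof (cases "c \<in> atlas \<and> x \<in> chart_image c")
  case False
  then have "\<alpha> c x = (\<lambda>vs. 0)" using A_eq_0[OF assms] by blast
  then show ?thesis by (simp add: alternating_multilinear_zero)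
qed (use assms in \<open>auto simp: A_def\<close>)

lemmas A_length = alternating_multilinear_length[OF A_alternating]
  and A_slotwise_linear = alternating_multilinear_slotwise_linear[OF A_alternating]
  and A_slot_antisymmetric = alternating_multilinear_slot_antisymmetric[OF A_alternating]
  and A_repeat = alternating_multilinear_repeat[OF A_alternating]

lemma A_smooth: "\<alpha> \<in> A atlas k \<Longrightarrow> c \<in> atlas \<Longrightarrow> smooth_on (chart_image c) (\<lambda>x. \<alpha> c x vs)"
  by (simp add: A_def)

lemma A_differentiable:
  assumes "\<alpha> \<in> A atlas k" "x \<in> chart_image c"
  shows "(\<lambda>x. \<alpha> c x vs) differentiable (at x)"
proof (cases "c \<in> atlas")
  case False
  then have "(\<lambda>x. \<alpha> c x vs) = (\<lambda>x. 0)" using A_eq_0[OF assms(1)] by blast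
  then show ?thesis by simp
qed (use assms A_smooth smooth_on_differentiable in blast)

lemma A_transition:
  "\<alpha> \<in> A atlas k \<Longrightarrow> c \<in> atlas \<Longrightarrow> d \<in> atlas \<Longrightarrow> x \<in> overlap c d \<Longrightarrow>
    \<alpha> c x vs = \<alpha> d (transition c d x) (map (transition_deriv c d x) vs)"
  by (simp add: A_def)

lemma A_I:
  assumes "\<And>c x vs. c \<notin> atlas \<or> x \<notin> chart_image c \<Longrightarrow> \<alpha> c x vs = 0"
    and "\<And>c x. c \<in> atlas \<Longrightarrow> x \<in> chart_image c \<Longrightarrow> alternating_multilinear k (\<alpha> c x)"
    and "\<And>c vs. c \<in> atlas \<Longrightarrow> smooth_on (chart_image c) (\<lambda>x. \<alpha> c x vs)"
    and "\<And>c d x vs. c \<in> atlas \<Longrightarrow> d \<in> atlas \<Longrightarrow> x \<in> overlap c d \<Longrightarrow>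
      \<alpha> c x vs = \<alpha> d (transition c d x) (map (transition_deriv c d x) vs)"
  shows "\<alpha> \<in> A atlas k"
  using assms unfolding A_def by blast

lemma ext_d_add:
  assumes "\<alpha> \<in> A atlas k" "\<beta> \<in> A atlas k"
  shows "ext_d (\<alpha> + \<beta>) = ext_d \<alpha> + ext_d \<beta>"
  by (intro ext) (simp add: ext_d_def frechet_derivative_add A_differentiable[OF assms(1)]
      A_differentiable[OF assms(2)] sum.distrib distrib_left)

lemma ext_d_scale:
  assumes "\<alpha> \<in> A atlas k"
  shows "ext_d (scale_form a \<alpha>) = scale_form a (ext_d \<alpha>)"
  by (intro ext) (simp add: ext_d_def scale_form_def frechet_derivative_mult A_differentiable[OF assms]
      sum_distrib_left mult.left_commute)

lemma ext_d_zero: "ext_d 0 = 0"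
  by (intro ext) (simp add: ext_d_def)

context smooth_atlas
begin

lemma A_zero: "0 \<in> A atlas k"
  by (rule A_I) (auto simp: zero_fun_def alternating_multilinear_zero smooth_on_const)

lemma A_add:
  assumes "\<alpha> \<in> A atlas k" "\<beta> \<in> A atlas k"
  shows "\<alpha> + \<beta> \<in> A atlas k"
proof (rule A_I)
  show "smooth_on (chart_image c) (\<lambda>x. (\<alpha> + \<beta>) c x vs)" if "c \<in> atlas" for c vs
    using smooth_on_add[OF open_chart_image A_smooth A_smooth] assms that by simp
  show "alternating_multilinear k ((\<alpha> + \<beta>) c x)" for c x
    using alternating_multilinear_add[OF A_alternating[OF assms(1)] A_alternating[OF assms(2)]]
    by (simp add: plus_fun_def)
qed (use A_eq_0[OF assms(1)] A_eq_0[OF assms(2)] A_transition[OF assms(1)] A_transition[OF assms(2)]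
    in auto)

lemma A_scale:
  assumes "\<alpha> \<in> A atlas k"
  shows "scale_form a \<alpha> \<in> A atlas k"
proof (rule A_I)
  show "smooth_on (chart_image c) (\<lambda>x. scale_form a \<alpha> c x vs)" if "c \<in> atlas" for c vs
    unfolding scale_form_def
    by (intro smooth_on_mult open_chart_image smooth_on_const A_smooth[OF assms] that)
  show "alternating_multilinear k (scale_form a \<alpha> c x)" for c x
    using alternating_multilinear_scale[OF A_alternating[OF assms]]
    by (simp add: scale_form_def)
qed (use A_eq_0[OF assms] A_transition[OF assms] in \<open>auto simp: scale_form_def\<close>)

text \<open>Stated for a general endomorphism field because it is applied to J and to the rotations
  exp(tJ). The conditions on \<open>K\<close> say that it is a smooth tensor field.\<close>

lemma A_act:
  assumes \<alpha>: "\<alpha> \<in> A atlas k"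
    and linear: "\<And>c x. c \<in> atlas \<Longrightarrow> x \<in> chart_image c \<Longrightarrow> linear (K c x)"
    and smooth: "\<And>c v. c \<in> atlas \<Longrightarrow> smooth_on (chart_image c) (\<lambda>x. K c x v)"
    and transition: "\<And>c d x v. c \<in> atlas \<Longrightarrow> d \<in> atlas \<Longrightarrow> x \<in> overlap c d \<Longrightarrow>
        transition_deriv c d x (K c x v) = K d (transition c d x) (transition_deriv c d x v)"
  shows "act K \<alpha> \<in> A atlas k"
proof (rule A_I)
  obtain E :: "'e set" and co where basis: "\<And>v. v = (\<Sum>b\<in>E. (v \<bullet> co b) *\<^sub>R b)"
    using dual_basis by blast
  show "smooth_on (chart_image c) (\<lambda>x. act K \<alpha> c x vs)" if "c \<in> atlas" for c vs
    using smooth_on_multilinear_map[OF basis open_chart_image[OF that] A_slotwise_linear[OF \<alpha>]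
        A_smooth[OF \<alpha> that] smooth[OF that], of "[]"]
    by (simp add: act_def)
  show "alternating_multilinear k (act K \<alpha> c x)" if "c \<in> atlas" "x \<in> chart_image c" for c x
    unfolding act_def by (intro alternating_multilinear_map A_alternating[OF \<alpha>] linear that)
  show "act K \<alpha> c x vs = act K \<alpha> d (transition c d x) (map (transition_deriv c d x) vs)"
    if "c \<in> atlas" "d \<in> atlas" "x \<in> overlap c d" for c d x vs
    using A_transition[OF \<alpha> that] transition[OF that] by (simp add: act_def o_def)
qed (use A_eq_0[OF \<alpha>] in \<open>auto simp: act_def\<close>)

text \<open>In the summand with omitted index \<open>i\<close>, the varying vector is the direction
  of differentiation if \<open>i = length us\<close>, and otherwise an argument of the
  differentiated form. Both dependences are linear.\<close>

lemma ext_d_slotwise_linear: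
  assumes \<alpha>: "\<alpha> \<in> A atlas k"
  shows "slotwise_linear (ext_d \<alpha> c x)"
proof (cases "x \<in> chart_image c")
  case x: True
  have lin: "linear (\<lambda>v. frechet_derivative (\<lambda>y. \<alpha> c y (us @ v # ws)) (at x) w)" for us ws w
    by (simp add: linear_iff linear_add[OF slotwise_linearD[OF A_slotwise_linear[OF \<alpha>]]]
        linear_scale[OF slotwise_linearD[OF A_slotwise_linear[OF \<alpha>]]]
        frechet_derivative_add frechet_derivative_scaleR A_differentiable[OF \<alpha> x])
  show ?thesis
    unfolding slotwise_linear_def
  proof (intro allI)
    fix us ws :: "'e list"
    have "linear (\<lambda>v. (-1) ^ i *
        frechet_derivative (\<lambda>y. \<alpha> c y (take i (us @ v # ws) @ drop (Suc i) (us @ v # ws))) (at x)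
          ((us @ v # ws) ! i))" (is "linear (\<lambda>v. _ * ?g v)") for i
    proof -
      consider "i < length us" | "i = length us" | j where "i = length us + Suc j"
        by (metis add_Suc_right less_imp_Suc_add linorder_neqE_nat)
      then have "linear ?g"
      proof cases
        case 1
        then show ?thesis using lin[of "take i us @ drop (Suc i) us" ws "us ! i"]
          by (simp add: nth_append)
      next
        case 2
        then show ?thesis using linear_frechet_derivative[OF A_differentiable[OF \<alpha> x, of "us @ ws"]]
          by simp
      next
        case 3
        then show ?thesis using lin[of us "take j ws @ drop (Suc j) ws" "ws ! j"]
          by (simp add: nth_append)
      qed
      then show ?thesis by (auto simp: linear_iff algebra_simps)
    qed
    then have "linear (\<lambda>v. \<Sum>i<length us + Suc (length ws). (-1) ^ i *
        frechet_derivative (\<lambda>y. \<alpha> c y (take i (us @ v # ws) @ drop (Suc i) (us @ v # ws))) (at x)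
          ((us @ v # ws) ! i))"
      by (intro linear_compose_sum ballI)
    then show "linear (\<lambda>v. ext_d \<alpha> c x (us @ v # ws))"
      using x by (simp only: ext_d_def if_True length_append list.size(4) add_Suc_right add_0_right)
  qed
next
  case False
  then show ?thesis by (simp add: ext_d_def slotwise_linear_def linear_zero)
qed

text \<open>Omitting any entry other than the two copies of \<open>v\<close> leaves a repeated
  argument. The two remaining summands differ by moving \<open>v\<close> past \<open>ms\<close>,
  with sign \<open>(-1) ^ length ms\<close>, while their index signs differ by
  \<open>(-1) ^ Suc (length ms)\<close>; so they cancel.\<close>

lemma ext_d_repeat:
  assumes \<alpha>: "\<alpha> \<in> A atlas k"
  shows "ext_d \<alpha> c x (us @ v # ms @ v # ws) = 0"
proof (cases "x \<in> chart_image c")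
  case x: True
  let ?L = "us @ v # ms @ v # ws"
  let ?a = "length us" and ?b = "length us + Suc (length ms)"
  define t where "t i = (-1) ^ i * frechet_derivative (\<lambda>y. \<alpha> c y (take i ?L @ drop (Suc i) ?L)) (at x) (?L ! i)"
    for i
  have 0: "t i = 0" if "i \<noteq> ?a" "i \<noteq> ?b" for i
  proof -
    have "i < ?a \<or> (\<exists>j. i = ?a + Suc j \<and> j < length ms) \<or> (\<exists>j. i = ?b + Suc j)"
      using that by presburger
    then consider "i < ?a" | j where "i = ?a + Suc j" "j < length ms" | j where "i = ?b + Suc j"
      by blast
    then have "\<alpha> c y (take i ?L @ drop (Suc i) ?L) = 0" for y
    proof cases
      case 1
      then show ?thesis using A_repeat[OF \<alpha>, of c y "take i us @ drop (Suc i) us"] by simp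
    next
      case 2
      then show ?thesis using A_repeat[OF \<alpha>, of c y us v "take j ms @ drop (Suc j) ms"] by simp
    next
      case 3
      define as where "as = us @ v # ms @ [v]"
      have L: "?L = as @ ws" and i: "i = length as + j" using 3 by (simp_all add: as_def)
      have "take i ?L @ drop (Suc i) ?L = as @ take j ws @ drop (Suc j) ws"
        unfolding L i by simp
      then show ?thesis using A_repeat[OF \<alpha>, of c y us v ms "take j ws @ drop (Suc j) ws"]
        by (simp add: as_def)
    qed
    then show ?thesis by (simp add: t_def)
  qed
  have "ext_d \<alpha> c x ?L = (\<Sum>i<length ?L. t i)"
    using x by (simp add: ext_d_def t_def)
  also have "\<dots> = (\<Sum>i\<in>{?a, ?b}. t i)"
    using 0 by (intro sum.mono_neutral_right) auto
  also have "\<dots> = t ?a + t ?b" by simp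
  also have "t ?b = - t ?a"
  proof -
    have "\<alpha> c y (us @ v # ms @ ws) = (-1) ^ length ms * \<alpha> c y (us @ ms @ v # ws)" for y
      by (rule slot_antisymmetric_move[OF A_slot_antisymmetric[OF \<alpha>]])
    then show ?thesis
      by (simp add: t_def nth_append frechet_derivative_mult A_differentiable[OF \<alpha> x] power_add)
  qed
  finally show ?thesis by simp
qed (simp add: ext_d_def)

lemma ext_d_alternating:
  assumes \<alpha>: "\<alpha> \<in> A atlas k"
  shows "alternating_multilinear (Suc k) (ext_d \<alpha> c x)"
proof (rule alternating_multilinearI)
  fix vs :: "'e list" assume "length vs \<noteq> Suc k"
  then have "\<alpha> c y (take i vs @ drop (Suc i) vs) = 0" if "i < length vs" for i y
    using that by (intro A_length[OF \<alpha>]) auto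
  then show "ext_d \<alpha> c x vs = 0"
    by (simp add: ext_d_def)
qed (use ext_d_slotwise_linear[OF \<alpha>] ext_d_repeat[OF \<alpha>] in auto)

text \<open>Differentiating the transformation law of \<open>\<alpha>\<close> gives the transformed
  exterior derivative plus terms with a second derivative \<open>H\<close> of the coordinate change
  in one slot. \<open>H\<close> is symmetric and the form alternating, so these terms cancel in
  pairs.\<close>

lemma ext_d_transition:
  assumes \<alpha>: "\<alpha> \<in> A atlas k" and c: "c \<in> atlas" and d: "d \<in> atlas" and x: "x \<in> overlap c d"
  shows "ext_d \<alpha> c x vs = ext_d \<alpha> d (transition c d x) (map (transition_deriv c d x) vs)"
proof (cases vs)
  case Nil
  then show ?thesis by (simp add: ext_d_def)
next
  case (Cons v0 vs0)
  define N where "N = length vs0"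
  have N: "length vs = Suc N" using Cons N_def by simp
  let ?\<tau> = "transition c d" and ?T = "transition_deriv c d"
  define H where "H v w = frechet_derivative (\<lambda>y. ?T y w) (at x) v" for v w
  have H: "H v w = H w v" for v w
    unfolding H_def
    by (rule symmetric_second_derivative[OF open_overlap[OF c d] smooth_transition[OF c d] x])
  define f where "f = \<alpha> d (?\<tau> x)"
  define del where "del i us = take i us @ drop (Suc i) us" for i and us :: "'e list"
  have del_map: "map h (del i us) = del i (map h us)" for h i us
    by (simp add: del_def take_map drop_map)
  obtain E :: "'e set" and co where basis: "\<And>v. v = (\<Sum>b\<in>E. (v \<bullet> co b) *\<^sub>R b)"
    using dual_basis by blast
  have x': "x \<in> chart_image c" using subsetD[OF overlap_subset x] .
  have \<tau>x: "?\<tau> x \<in> chart_image d" by (rule transition_in[OF c x])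
  have D: "frechet_derivative (\<lambda>y. \<alpha> c y us) (at x) v =
      frechet_derivative (\<lambda>z. \<alpha> d z (map (?T x) us)) (at (?\<tau> x)) (?T x v) +
      (\<Sum>j<length us. f (take j (map (?T x) us) @ H v (us ! j) # drop (Suc j) (map (?T x) us)))" for us v
  proof -
    have "((\<lambda>y. \<alpha> d (?\<tau> y) ([] @ map (?T y) us)) has_derivative
      (\<lambda>v. frechet_derivative (\<lambda>z. \<alpha> d z ([] @ map (?T x) us)) (at (?\<tau> x)) (?T x v) +
        (\<Sum>j<length us. \<alpha> d (?\<tau> x) ([] @ take j (map (?T x) us) @
          frechet_derivative (\<lambda>y. ?T y (us ! j)) (at x) v # drop (Suc j) (map (?T x) us))))) (at x)"
      using smooth_transition[OF c d] x
      by (intro has_derivative_multilinear_map[where f = "\<alpha> d" and \<tau> = "?\<tau>" and K = "?T",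
            OF basis A_slotwise_linear[OF \<alpha>] A_differentiable[OF \<alpha> \<tau>x]]
          smooth_on_has_derivative smooth_on_differentiable[OF smooth_on_frechet_derivative])
    then have "((\<lambda>y. \<alpha> d (?\<tau> y) (map (?T y) us)) has_derivative
      (\<lambda>v. frechet_derivative (\<lambda>z. \<alpha> d z (map (?T x) us)) (at (?\<tau> x)) (?T x v) +
      (\<Sum>j<length us. f (take j (map (?T x) us) @ H v (us ! j) # drop (Suc j) (map (?T x) us))))) (at x)"
      by (simp add: f_def H_def)
    note has_derivative_transform_within_open[OF this open_overlap[OF c d] x A_transition[OF \<alpha> c d, symmetric]]
    from frechet_derivative_at[OF this, THEN fun_cong, of v] show ?thesis by (rule sym)
  qed
  let ?us = "map (?T x) vs"
  \<comment> \<open>The second order term with direction \<open>vs ! i\<close> and with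
    \<open>H\<close> in slot \<open>j\<close> of the list from which that entry has been
    removed.\<close>
  define S where "S i j = (-1) ^ i *
    f (take j (del i ?us) @ H (vs ! i) (del i vs ! j) # drop (Suc j) (del i ?us))" for i j
  have "S (Suc j) i = - S i j" if "i \<le> j" "j < N" for i j
  proof -
    \<comment> \<open>Cuts \<open>vs\<close> at the entries \<open>i\<close> and
      \<open>Suc j\<close>. The latter has index \<open>j\<close> once entry \<open>i\<close> is
      removed.\<close>
    define P where "P = take i vs"
    define Q where "Q = take (j - i) (drop (Suc i) vs)"
    define R where "R = drop (Suc (Suc j)) vs"
    have "vs = P @ vs ! i # drop (Suc i) vs"
      unfolding P_def using that N by (intro id_take_nth_drop) simp
    moreover have "drop (Suc i) vs = Q @ vs ! Suc j # R"
      using that N id_take_nth_drop[of "j - i" "drop (Suc i) vs"] by (simp add: Q_def R_def)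
    ultimately obtain a b where vs: "vs = P @ a # Q @ b # R" by metis
    have len: "length P = i" "length Q = j - i" using that N by (simp_all add: P_def Q_def)
    have nth: "vs ! i = a" "vs ! Suc j = b" and del: "del i vs = P @ Q @ b # R" "del (Suc j) vs = P @ a # Q @ R"
      using that len Suc_diff_le[of i j] Suc_diff_le[of i "Suc j"] by (auto simp: vs del_def nth_append)
    have nth': "del i vs ! j = b" "del (Suc j) vs ! i = a"
      unfolding del using that len by (auto simp: nth_append)
    \<comment> \<open>The common value up to sign: \<open>S i j\<close> has \<open>H a b\<close>
      behind \<open>Q\<close>, whereas \<open>S (Suc j) i\<close> has it in front of
      \<open>Q\<close>. The total sign \<open>(-1) ^ (Suc j + (j - i))\<close> is opposite to
      \<open>(-1) ^ i\<close>.\<close>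
    define fQ where "fQ = f (map (?T x) P @ map (?T x) Q @ H a b # map (?T x) R)"
    have "f (map (?T x) P @ H a b # map (?T x) Q @ map (?T x) R) = (-1) ^ (j - i) * fQ"
      unfolding f_def fQ_def
      using slot_antisymmetric_move[OF A_slot_antisymmetric[OF \<alpha>], of d "?\<tau> x" "map (?T x) P" "H a b"
          "map (?T x) Q"] len by simp
    then have "S (Suc j) i = (-1) ^ Suc j * ((-1) ^ (j - i) * fQ)"
      unfolding S_def del_map[symmetric] nth nth' H[of b a] unfolding del using len by simp
    moreover have "S i j = (-1) ^ i * fQ"
      unfolding S_def del_map[symmetric] nth nth' fQ_def unfolding del using that len by simp
    moreover from le_Suc_ex[OF that(1)] obtain q where "j = i + q" by blast
    ultimately show ?thesis by (simp add: power_add)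
  qed
  then have 0: "(\<Sum>i<Suc N. \<Sum>j<N. S i j) = 0" by (rule sum_antisymmetric_eq_0)
  have "ext_d \<alpha> c x vs = (\<Sum>i<Suc N. (-1) ^ i * frechet_derivative (\<lambda>y. \<alpha> c y (del i vs)) (at x) (vs ! i))"
    using x' by (simp add: ext_d_def N del_def)
  also have "\<dots> = (\<Sum>i<Suc N. (-1) ^ i *
      frechet_derivative (\<lambda>z. \<alpha> d z (del i ?us)) (at (?\<tau> x)) (?T x (vs ! i)) + (\<Sum>j<N. S i j))"
  proof (rule sum.cong[OF refl])
    fix i assume i: "i \<in> {..<Suc N}"
    then have "length (del i vs) = N" using N by (simp add: del_def)
    then show "(-1) ^ i * frechet_derivative (\<lambda>y. \<alpha> c y (del i vs)) (at x) (vs ! i) =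
      (-1) ^ i * frechet_derivative (\<lambda>z. \<alpha> d z (del i ?us)) (at (?\<tau> x)) (?T x (vs ! i)) + (\<Sum>j<N. S i j)"
      by (simp add: D S_def del_map distrib_left sum_distrib_left)
  qed
  also have "\<dots> = (\<Sum>i<Suc N. (-1) ^ i *
      frechet_derivative (\<lambda>z. \<alpha> d z (del i ?us)) (at (?\<tau> x)) (?us ! i))"
    unfolding sum.distrib 0 using N by simp
  also have "\<dots> = ext_d \<alpha> d (?\<tau> x) ?us"
    using \<tau>x by (simp add: ext_d_def N del_def)
  finally show ?thesis .
qed

lemma A_ext_d:
  assumes \<alpha>: "\<alpha> \<in> A atlas k"
  shows "ext_d \<alpha> \<in> A atlas (Suc k)"
proof (rule A_I)
  fix c x and vs :: "'e list" assume "c \<notin> atlas \<or> x \<notin> chart_image c"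
  then consider "x \<notin> chart_image c" | "\<And>y vs. \<alpha> c y vs = 0" using A_eq_0[OF \<alpha>] by blast
  then show "ext_d \<alpha> c x vs = 0"
    by cases (simp_all add: ext_d_def)
next
  fix c and vs :: "'e list" assume c: "c \<in> atlas"
  have "smooth_on (chart_image c) (\<lambda>x. \<Sum>i<length vs. (-1) ^ i *
      frechet_derivative (\<lambda>y. \<alpha> c y (take i vs @ drop (Suc i) vs)) (at x) (vs ! i))"
    using open_chart_image[OF c]
    by (intro smooth_on_sum smooth_on_mult smooth_on_const smooth_on_frechet_derivative A_smooth[OF \<alpha> c])
  then show "smooth_on (chart_image c) (\<lambda>x. ext_d \<alpha> c x vs)"
    by (rule smooth_on_cong[OF open_chart_image[OF c], rotated]) (simp add: ext_d_def)
qed (use ext_d_alternating[OF \<alpha>] ext_d_transition[OF \<alpha>] in auto)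

end


section \<open>The bigrading\<close>

text \<open>A geometric sum over the powers of a root of unity of order dividing k + 1. The bound on
  \<open>l\<close> excludes nonzero multiples of k + 1, so the root is not 1.\<close>

lemma sum_cis_eq_0:
  fixes l :: int
  assumes "l \<noteq> 0" "\<bar>l\<bar> \<le> int k"
  shows "(\<Sum>j\<le>k. cis (2 * pi * of_int l * real j / real (Suc k))) = 0"
proof -
  define z where "z = cis (2 * pi * of_int l / real (Suc k))"
  have "z \<noteq> 1"
  proof
    assume "z = 1"
    then have "cos (2 * pi * of_int l / real (Suc k)) = 1" by (simp add: z_def complex_eq_iff)
    then obtain q :: int where "2 * pi * of_int l / real (Suc k) = of_int q * 2 * pi"
      unfolding cos_one_2pi_int by auto
    then have "2 * pi * of_int l = 2 * pi * (of_int q * real (Suc k))"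
      by (simp add: divide_eq_eq mult_ac del: of_nat_Suc)
    then have "of_int l = of_int q * real (Suc k)" by simp
    then have l: "l = q * int (Suc k)"
      by (metis of_int_eq_iff of_int_mult of_int_of_nat_eq)
    then have "\<bar>l\<bar> = \<bar>q\<bar> * int (Suc k)" by (simp add: abs_mult)
    moreover have "1 \<le> \<bar>q\<bar>" using l assms(1) by auto
    ultimately have "int (Suc k) \<le> \<bar>l\<bar>"
      by (metis mult_1 mult_right_mono of_nat_0_le_iff)
    then show False using assms(2) by simp
  qed
  moreover have "(1 - z) * (\<Sum>j\<le>k. z ^ j) = 1 - z ^ Suc k"
    by (rule sum_gp_basic)
  moreover have "z ^ Suc k = 1"
  proof -
    have "z ^ Suc k = cis (real (Suc k) * (2 * pi * of_int l / real (Suc k)))"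
      unfolding z_def by (rule Complex.DeMoivre)
    also have "real (Suc k) * (2 * pi * of_int l / real (Suc k)) = 2 * pi * of_int l"
      by (simp del: of_nat_Suc)
    finally show ?thesis by simp
  qed
  ultimately have "(\<Sum>j\<le>k. z ^ j) = 0" by simp
  moreover have "z ^ j = cis (2 * pi * of_int l * real j / real (Suc k))" for j
    unfolding z_def Complex.DeMoivre by (simp add: mult_ac)
  ultimately show ?thesis by simp
qed

lemma sum_form_apply: "(\<Sum>i\<in>I. \<beta> i) c x vs = (\<Sum>i\<in>I. \<beta> i c x vs)"
  for \<beta> :: "'i \<Rightarrow> ('a, 'e) form"
  by (induction I rule: infinite_finite_induct) auto

lemma scale_form_simps:
  "scale_form a (\<alpha> + \<beta>) = scale_form a \<alpha> + scale_form a \<beta>"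
  "scale_form (a + b) \<alpha> = scale_form a \<alpha> + scale_form b \<alpha>"
  "scale_form a (scale_form b \<alpha>) = scale_form (a * b) \<alpha>"
  "scale_form 1 \<alpha> = \<alpha>" "scale_form a 0 = 0" "scale_form 0 \<alpha> = 0"
  by (intro ext; simp add: scale_form_def algebra_simps)+

lemma act_add: "act K (\<alpha> + \<beta>) = act K \<alpha> + act K \<beta>"
  by (intro ext) (simp add: act_def)

lemma act_scale: "act K (scale_form a \<alpha>) = scale_form a (act K \<alpha>)"
  by (intro ext) (simp add: act_def scale_form_def)

lemma act_zero: "act K 0 = 0"
  by (intro ext) (simp add: act_def)

text \<open>Gives the action of the inverse -J of J, and with the identity as \<open>K\<close> also
  that of the square of J.\<close>

lemma act_uminus:
  assumes "\<alpha> \<in> A atlas k"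
  shows "act (\<lambda>c x v. - K c x v) \<alpha> = scale_form ((-1) ^ k) (act K \<alpha>)"
proof (intro ext)
  fix c x and vs :: "'b list"
  have "\<alpha> c x ([] @ map (\<lambda>v. (-1) *\<^sub>R v) (map (K c x) vs)) =
      (-1) ^ length (map (K c x) vs) *\<^sub>R \<alpha> c x ([] @ map (K c x) vs)"
    by (rule slotwise_linear_map_scaleR[OF A_slotwise_linear[OF assms]])
  then have "\<alpha> c x (map (\<lambda>v. - K c x v) vs) = (-1) ^ length vs *\<^sub>R \<alpha> c x (map (K c x) vs)"
    by (simp add: o_def)
  then show "act (\<lambda>c x v. - K c x v) \<alpha> c x vs = scale_form ((-1) ^ k) (act K \<alpha>) c x vs"
    using A_length[OF assms, of "map (K c x) vs" c x]
    by (cases "length vs = k") (auto simp: act_def scale_form_def scaleR_conv_of_real)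
qed

section \<open>Complex subspaces of forms and the action of J\<close>

definition form_subspace :: "('a, 'e) form set \<Rightarrow> bool" where
  "form_subspace V \<longleftrightarrow> 0 \<in> V \<and> (\<forall>\<alpha>\<in>V. \<forall>\<beta>\<in>V. \<alpha> + \<beta> \<in> V) \<and> (\<forall>a. \<forall>\<alpha>\<in>V. scale_form a \<alpha> \<in> V)"

lemma form_subspaceD:
  assumes "form_subspace V"
  shows "0 \<in> V" "\<alpha> \<in> V \<Longrightarrow> \<beta> \<in> V \<Longrightarrow> \<alpha> + \<beta> \<in> V" "\<alpha> \<in> V \<Longrightarrow> scale_form a \<alpha> \<in> V"
  using assms by (auto simp: form_subspace_def)

lemma form_subspace_diff:
  assumes "form_subspace V" "\<alpha> \<in> V" "\<beta> \<in> V"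
  shows "\<alpha> - \<beta> \<in> V"
proof -
  have "\<alpha> - \<beta> = \<alpha> + scale_form (-1) \<beta>" by (intro ext) (simp add: scale_form_def)
  then show ?thesis using form_subspaceD[OF assms(1)] assms(2,3) by metis
qed

lemma form_subspace_sum:
  assumes "form_subspace V" "\<And>i. i \<in> I \<Longrightarrow> \<beta> i \<in> V"
  shows "(\<Sum>i\<in>I. \<beta> i) \<in> V"
  using assms(2)
  by (induction I rule: infinite_finite_induct) (auto simp: form_subspaceD[OF assms(1)])

locale almost_complex = smooth_atlas n X atlas
  for n and X :: "'a topology" and atlas :: "('a, 'e::real_inner) chart set" +
  fixes J :: "('a, 'e) endo_field"
  assumes almost_complex_structure: "almost_complex_structure atlas J"
begin

lemma J_linear: "c \<in> atlas \<Longrightarrow> x \<in> chart_image c \<Longrightarrow> linear (J c x)"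
  and J_smooth: "c \<in> atlas \<Longrightarrow> smooth_on (chart_image c) (\<lambda>x. J c x v)"
  and J_transition: "c \<in> atlas \<Longrightarrow> d \<in> atlas \<Longrightarrow> x \<in> overlap c d \<Longrightarrow>
    transition_deriv c d x (J c x v) = J d (transition c d x) (transition_deriv c d x v)"
  and J_J: "c \<in> atlas \<Longrightarrow> x \<in> chart_image c \<Longrightarrow> J c x (J c x v) = - v"
  using almost_complex_structure by (auto simp: almost_complex_structure_def)

lemma form_subspace_A: "form_subspace (A atlas k)"
  by (simp add: form_subspace_def A_zero A_add A_scale)

lemma A_act_J: "\<alpha> \<in> A atlas k \<Longrightarrow> act J \<alpha> \<in> A atlas k"
  by (intro A_act J_linear J_smooth J_transition)

text \<open>This is exp(tJ), since J squares to -1.\<close>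

definition rotation :: "real \<Rightarrow> ('a, 'e) endo_field" where
  "rotation t = (\<lambda>c x v. cos t *\<^sub>R v + sin t *\<^sub>R J c x v)"

lemma A_act_rotation:
  assumes "\<alpha> \<in> A atlas k"
  shows "act (rotation t) \<alpha> \<in> A atlas k"
proof (rule A_act[OF assms])
  fix c x assume "c \<in> atlas" "x \<in> chart_image c"
  from J_linear[OF this] show "linear (rotation t c x)"
    by (simp add: rotation_def linear_iff algebra_simps)
next
  fix c v assume "c \<in> atlas"
  then show "smooth_on (chart_image c) (\<lambda>x. rotation t c x v)"
    unfolding rotation_def
    by (intro smooth_on_add smooth_on_scaleR smooth_on_const J_smooth open_chart_image)
next
  fix c d x v assume *: "c \<in> atlas" "d \<in> atlas" "x \<in> overlap c d"
  show "transition_deriv c d x (rotation t c x v) =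
      rotation t d (transition c d x) (transition_deriv c d x v)"
    using linear_transition_deriv[OF *] J_transition[OF *]
    by (simp add: rotation_def linear_add linear_scale)
qed

lemma act_J_J:
  assumes "\<alpha> \<in> A atlas k"
  shows "act J (act J \<alpha>) = scale_form ((-1) ^ k) \<alpha>"
proof -
  have "act J (act J \<alpha>) c x vs = act (\<lambda>c x v. - v) \<alpha> c x vs" for c x vs
    using J_J A_eq_0[OF assms]
    by (cases "c \<in> atlas \<and> x \<in> chart_image c") (auto simp: act_def o_def)
  then have "act J (act J \<alpha>) = act (\<lambda>c x v. - v) \<alpha>" by blast
  also have "\<dots> = scale_form ((-1) ^ k) (act (\<lambda>c x v. v) \<alpha>)" by (rule act_uminus[OF assms])
  also have "act (\<lambda>c x v. v) \<alpha> = \<alpha>" by (simp add: act_def)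
  finally show ?thesis .
qed

text \<open>Both sides agree on every sorted list of typed vectors: with p vectors of type (1,0) by
  \<open>complexify_rotate\<close>, and otherwise because both vanish.
  \<open>alternating_multilinear_eq_0\<close>, applied to the difference \<open>g\<close>, then
  gives equality on real vectors.\<close>

lemma act_J_Apq:
  assumes "\<alpha> \<in> Apq atlas J p q"
  shows "act J \<alpha> = scale_form (\<i> ^ p * (- \<i>) ^ q) \<alpha>"
proof (intro ext)
  fix c x vs
  have \<alpha>: "\<alpha> \<in> A atlas (p + q)" using assms by (simp add: Apq_def)
  show "act J \<alpha> c x vs = scale_form (\<i> ^ p * (- \<i>) ^ q) \<alpha> c x vs"
  proof (cases "c \<in> atlas \<and> x \<in> chart_image c")
    case True
    then have JJ: "J c x (J c x v) = - v" for v using J_J by blast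
    define g where "g vs = act J \<alpha> c x vs + (- (\<i> ^ p * (- \<i>) ^ q)) * \<alpha> c x vs" for vs
    have "g vs = 0"
    proof (rule alternating_multilinear_eq_0[of "J c x", OF JJ])
      show "alternating_multilinear (p + q) g"
        unfolding g_def
        by (intro alternating_multilinear_add alternating_multilinear_scale
            A_alternating[OF A_act_J[OF \<alpha>]] A_alternating[OF \<alpha>])
      fix zs ws assume zs: "set zs \<subseteq> T10 (J c x)" and ws: "set ws \<subseteq> T01 (J c x)"
        and len: "length zs + length ws = p + q"
      have "complexify (act J \<alpha> c x) (zs @ ws) =
          \<i> ^ length zs * (- \<i>) ^ length ws * complexify (\<alpha> c x) (zs @ ws)"
        using complexify_rotate[OF A_slotwise_linear[OF \<alpha>] zs ws, where a = 0 and b = 1]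
        by (simp add: act_def Complex_eq)
      moreover have "complexify (\<alpha> c x) (zs @ ws) = 0" if "length zs \<noteq> p"
        using assms True zs ws len that unfolding Apq_def by blast
      moreover have "length ws = q" if "length zs = p" using len that by simp
      ultimately show "complexify g (zs @ ws) = 0"
        unfolding g_def complexify_add complexify_scale by (cases "length zs = p") auto
    qed
    then show ?thesis by (simp add: g_def scale_form_def eq_neg_iff_add_eq_0)
  qed (use A_eq_0[OF \<alpha>] in \<open>auto simp: act_def scale_form_def\<close>)
qed

section \<open>Projection onto pure types by averaging over rotations\<close>

text \<open>The rotation by the angle \<open>t\<close> acts on \<open>A\<^sup>p\<^sup>,\<^sup>q\<close> as \<open>exp (\<i> (p - q) t)\<close>, so a discrete Fourier
  transform over the angles \<open>\<pi> j / (k + 1)\<close> isolates the component of type \<open>(p, k - p)\<close>.\<close>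

definition component :: "nat \<Rightarrow> nat \<Rightarrow> ('a, 'e) form \<Rightarrow> ('a, 'e) form" where
  "component k p \<alpha> = scale_form (1 / of_nat (Suc k)) (\<Sum>j\<le>k.
     scale_form (cis (pi * (real k - 2 * real p) * real j / real (Suc k)))
       (act (rotation (pi * real j / real (Suc k))) \<alpha>))"

lemma A_component: "\<alpha> \<in> A atlas k \<Longrightarrow> component k p \<alpha> \<in> A atlas k"
  unfolding component_def
  by (intro form_subspaceD(3)[OF form_subspace_A] form_subspace_sum[OF form_subspace_A] A_act_rotation)

text \<open>On r vectors of type (1,0) and k - r of type (0,1), rotation by t gives the factor exp(i
  (2r - k) t). With the weights, the sum runs over the powers of exp(2 pi i (r - p) / (k + 1)) and
  vanishes for r distinct from p.\<close>

lemma component_Apq: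
  assumes \<alpha>: "\<alpha> \<in> A atlas k" and p: "p \<le> k"
  shows "component k p \<alpha> \<in> Apq atlas J p (k - p)"
proof -
  have "complexify (component k p \<alpha> c x) (zs @ ws) = 0"
    if zs: "set zs \<subseteq> T10 (J c x)" and ws: "set ws \<subseteq> T01 (J c x)"
      and len: "length zs + length ws = k" "length zs \<noteq> p" for c x zs ws
  proof -
    define r where "r = length zs"
    have r: "r \<le> k" "real (length ws) = real k - real r" using len by (auto simp: r_def)
    have rot: "complexify (act (rotation t) \<alpha> c x) (zs @ ws) =
        cis ((2 * real r - real k) * t) * complexify (\<alpha> c x) (zs @ ws)" for t
    proof -
      have "Complex (cos t) (sin t) = cis t" "Complex (cos t) (- sin t) = cis (- t)"
        by (simp_all add: complex_eq_iff)
      moreover have "cis t ^ r * cis (- t) ^ length ws = cis ((2 * real r - real k) * t)"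
        unfolding Complex.DeMoivre cis_mult r by (simp add: algebra_simps)
      ultimately show ?thesis
        using complexify_rotate[OF A_slotwise_linear[OF \<alpha>] zs ws, where a = "cos t" and b = "sin t"]
        by (simp add: act_def rotation_def r_def[symmetric])
    qed
    \<comment> \<open>The frequencies combine to (k - 2p) + (2r - k) = 2 (r - p). Its factor 2 is
      why angles in a half turn already produce roots of unity of order k + 1.\<close>
    have angle: "cis (pi * (real k - 2 * real p) * real j / real (Suc k)) *
          (cis ((2 * real r - real k) * (pi * real j / real (Suc k))) * a) =
        cis (2 * pi * of_int (int r - int p) * real j / real (Suc k)) * a" for j a
    proof -
      have "pi * (real k - 2 * real p) * real j / real (Suc k) +
          (2 * real r - real k) * (pi * real j / real (Suc k)) =
          2 * pi * of_int (int r - int p) * real j / real (Suc k)"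
        unfolding times_divide_eq_right add_divide_distrib[symmetric]
        by (simp add: algebra_simps del: of_nat_Suc)
      then show ?thesis by (simp only: mult.assoc[symmetric] cis_mult)
    qed
    have "component k p \<alpha> c x = (\<lambda>vs. (1 / of_nat (Suc k)) * (\<Sum>j\<le>k.
        cis (pi * (real k - 2 * real p) * real j / real (Suc k)) *
        act (rotation (pi * real j / real (Suc k))) \<alpha> c x vs))"
      by (intro ext) (simp add: component_def scale_form_def sum_form_apply)
    then have "complexify (component k p \<alpha> c x) (zs @ ws) = (1 / of_nat (Suc k)) * (\<Sum>j\<le>k.
        cis (pi * (real k - 2 * real p) * real j / real (Suc k)) *
        (cis ((2 * real r - real k) * (pi * real j / real (Suc k))) * complexify (\<alpha> c x) (zs @ ws)))"
      by (simp only: complexify_scale complexify_sum rot)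
    also have "\<dots> = (1 / of_nat (Suc k)) *
        ((\<Sum>j\<le>k. cis (2 * pi * of_int (int r - int p) * real j / real (Suc k))) *
          complexify (\<alpha> c x) (zs @ ws))"
      by (simp only: angle sum_distrib_right)
    also have "(\<Sum>j\<le>k. cis (2 * pi * of_int (int r - int p) * real j / real (Suc k))) = 0"
      using r p len(2) by (intro sum_cis_eq_0) (auto simp: r_def)
    finally show ?thesis by simp
  qed
  then show ?thesis
    using A_component[OF \<alpha>] p by (simp add: Apq_def)
qed

text \<open>Fourier inversion: summing the weights over \<open>p\<close> kills every angle except
  \<open>j = 0\<close>, whose rotation is the identity.\<close>

lemma sum_component: "(\<Sum>p\<le>k. component k p \<alpha>) = \<alpha>"
proof (intro ext)
  fix c x vs
  let ?R = "\<lambda>j. act (rotation (pi * real j / real (Suc k))) \<alpha> c x vs"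
  have s: "(\<Sum>p\<le>k. cis (pi * (real k - 2 * real p) * real j / real (Suc k))) =
      (if j = 0 then of_nat (Suc k) else 0)" if "j \<le> k" for j
  proof (cases "j = 0")
    case False
    \<comment> \<open>Splits off the phase that does not depend on \<open>p\<close>. What remains is
      \<open>sum_cis_eq_0\<close> with \<open>l = - int j\<close>.\<close>
    have "cis (pi * (real k - 2 * real p) * real j / real (Suc k)) =
        cis (pi * real k * real j / real (Suc k)) *
        cis (2 * pi * of_int (- int j) * real p / real (Suc k))" for p
      unfolding cis_mult add_divide_distrib[symmetric]
      by (rule arg_cong[of _ _ cis]) (simp add: algebra_simps del: of_nat_Suc)
    then have "(\<Sum>p\<le>k. cis (pi * (real k - 2 * real p) * real j / real (Suc k))) =
        cis (pi * real k * real j / real (Suc k)) *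
        (\<Sum>p\<le>k. cis (2 * pi * of_int (- int j) * real p / real (Suc k)))"
      by (simp only: sum_distrib_left)
    also have "(\<Sum>p\<le>k. cis (2 * pi * of_int (- int j) * real p / real (Suc k))) = 0"
      using that False by (intro sum_cis_eq_0) auto
    finally show ?thesis using False by simp
  qed simp
  have "(\<Sum>p\<le>k. component k p \<alpha>) c x vs = (\<Sum>p\<le>k. (1 / of_nat (Suc k)) *
      (\<Sum>j\<le>k. cis (pi * (real k - 2 * real p) * real j / real (Suc k)) * ?R j))"
    by (simp add: component_def scale_form_def sum_form_apply)
  also have "\<dots> = (1 / of_nat (Suc k)) *
      (\<Sum>j\<le>k. (\<Sum>p\<le>k. cis (pi * (real k - 2 * real p) * real j / real (Suc k))) * ?R j)"
    unfolding sum_distrib_right by (subst sum.swap) (simp only: sum_distrib_left)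
  also have "\<dots> = (1 / of_nat (Suc k)) * (\<Sum>j\<le>k. if j = 0 then of_nat (Suc k) * ?R 0 else 0)"
    by (intro arg_cong2[of _ _ _ _ "(*)"] sum.cong refl) (simp add: s del: of_nat_Suc)
  also have "\<dots> = ?R 0"
    by (simp del: of_nat_Suc)
  also have "\<dots> = \<alpha> c x vs"
    by (simp add: act_def rotation_def)
  finally show "(\<Sum>p\<le>k. component k p \<alpha>) c x vs = \<alpha> c x vs" .
qed

section \<open>Parity as eigenspaces of J, and the projections onto them\<close>

definition eigenforms :: "nat \<Rightarrow> complex \<Rightarrow> ('a, 'e) form set" where
  "eigenforms k a = {\<alpha> \<in> A atlas k. act J \<alpha> = scale_form a \<alpha>}"

lemma form_subspace_eigenforms: "form_subspace (eigenforms k a)"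
  unfolding form_subspace_def eigenforms_def
  by (auto simp: A_zero A_add A_scale act_add act_scale act_zero scale_form_simps mult.commute)

lemma eigenforms_disjoint:
  assumes "\<alpha> \<in> eigenforms k a" "\<alpha> \<in> eigenforms k (- a)" "a \<noteq> 0"
  shows "\<alpha> = 0"
proof (intro ext)
  fix c x vs
  have "scale_form a \<alpha> c x vs = scale_form (- a) \<alpha> c x vs"
    using assms by (simp add: eigenforms_def)
  then show "\<alpha> c x vs = 0 c x vs"
    using assms(3) by (simp add: scale_form_def)
qed

lemma Apq_eigenforms:
  assumes "\<alpha> \<in> Apq atlas J p (k - p)" "p \<le> k"
  shows "\<alpha> \<in> eigenforms k ((-1) ^ p * (- \<i>) ^ k)"
proof -
  have "\<i> ^ p = (-1) ^ p * (- \<i>) ^ p" by (simp flip: power_mult_distrib)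
  then have "\<i> ^ p * (- \<i>) ^ (k - p) = (-1) ^ p * (- \<i>) ^ k"
    using assms(2) by (simp add: mult.assoc flip: power_add)
  then show ?thesis
    using act_J_Apq[OF assms(1)] assms by (simp add: eigenforms_def Apq_def)
qed

text \<open>Sums of pure types of one parity are eigenforms by \<open>Apq_eigenforms\<close>.
  Conversely, split \<open>\<alpha>\<close> into its even components \<open>e\<close> and odd
  components \<open>w\<close>. If \<open>\<alpha>\<close> has the even eigenvalue, then so does
  \<open>w = \<alpha> - e\<close>; as \<open>w\<close> also has the odd one, it is zero. The odd
  case is symmetric.\<close>

lemma A_ev_eq: "A_ev atlas J k = eigenforms k ((- \<i>) ^ k)"
  and A_od_eq: "A_od atlas J k = eigenforms k (- ((- \<i>) ^ k))"
proof -
  have ev: "(\<Sum>p | p \<le> k \<and> even p. \<beta> p) \<in> eigenforms k ((- \<i>) ^ k)"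
    if "\<And>p. p \<le> k \<Longrightarrow> even p \<Longrightarrow> \<beta> p \<in> Apq atlas J p (k - p)" for \<beta>
    using Apq_eigenforms[OF that] by (intro form_subspace_sum form_subspace_eigenforms) auto
  have od: "(\<Sum>p | p \<le> k \<and> odd p. \<beta> p) \<in> eigenforms k (- ((- \<i>) ^ k))"
    if "\<And>p. p \<le> k \<Longrightarrow> odd p \<Longrightarrow> \<beta> p \<in> Apq atlas J p (k - p)" for \<beta>
    using Apq_eigenforms[OF that] by (intro form_subspace_sum form_subspace_eigenforms) auto
  have split: "\<alpha> = (\<Sum>p | p \<le> k \<and> even p. component k p \<alpha>) + (\<Sum>p | p \<le> k \<and> odd p. component k p \<alpha>)"
    for \<alpha>
  proof -
    have "{..k} = {p. p \<le> k \<and> even p} \<union> {p. p \<le> k \<and> odd p}" by auto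
    then have "(\<Sum>p\<le>k. component k p \<alpha>) =
        (\<Sum>p | p \<le> k \<and> even p. component k p \<alpha>) + (\<Sum>p | p \<le> k \<and> odd p. component k p \<alpha>)"
      by (simp add: sum.union_disjoint[symmetric] disjoint_iff)
    then show ?thesis by (simp only: sum_component)
  qed
  have comp: "component k p \<alpha> \<in> Apq atlas J p (k - p)" if "\<alpha> \<in> eigenforms k a" "p \<le> k" for \<alpha> a p
    using that by (intro component_Apq) (simp_all add: eigenforms_def)
  have nz: "(- \<i>) ^ k \<noteq> 0" by simp
  show "A_ev atlas J k = eigenforms k ((- \<i>) ^ k)"
  proof (intro equalityI subsetI)
    fix \<alpha> assume \<alpha>: "\<alpha> \<in> eigenforms k ((- \<i>) ^ k)"
    define e where "e = (\<Sum>p | p \<le> k \<and> even p. component k p \<alpha>)"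
    define w where "w = (\<Sum>p | p \<le> k \<and> odd p. component k p \<alpha>)"
    have eq: "\<alpha> = e + w" unfolding e_def w_def by (rule split)
    have w: "w \<in> eigenforms k (- ((- \<i>) ^ k))" unfolding w_def using comp[OF \<alpha>] by (intro od)
    have "\<alpha> - e \<in> eigenforms k ((- \<i>) ^ k)"
      unfolding e_def using comp[OF \<alpha>] by (intro form_subspace_diff form_subspace_eigenforms \<alpha> ev)
    then have "w = 0" using eigenforms_disjoint[OF _ w nz] by (simp add: eq)
    then show "\<alpha> \<in> A_ev atlas J k" unfolding A_ev_def using eq e_def comp[OF \<alpha>] by auto
  qed (auto simp: A_ev_def ev)
  show "A_od atlas J k = eigenforms k (- ((- \<i>) ^ k))"
  proof (intro equalityI subsetI)
    fix \<alpha> assume \<alpha>: "\<alpha> \<in> eigenforms k (- ((- \<i>) ^ k))"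
    define e where "e = (\<Sum>p | p \<le> k \<and> even p. component k p \<alpha>)"
    define w where "w = (\<Sum>p | p \<le> k \<and> odd p. component k p \<alpha>)"
    have eq: "\<alpha> = e + w" unfolding e_def w_def by (rule split)
    have e: "e \<in> eigenforms k ((- \<i>) ^ k)" unfolding e_def using comp[OF \<alpha>] by (intro ev)
    have "\<alpha> - w \<in> eigenforms k (- ((- \<i>) ^ k))"
      unfolding w_def using comp[OF \<alpha>] by (intro form_subspace_diff form_subspace_eigenforms \<alpha> od)
    then have "e = 0" using eigenforms_disjoint[OF e _ nz] by (simp add: eq)
    then show "\<alpha> \<in> A_od atlas J k" unfolding A_od_def using eq w_def comp[OF \<alpha>] by auto
  qed (auto simp: A_od_def od)
qed

lemmas form_subspace_A_ev = form_subspace_eigenforms[of k "(- \<i>) ^ k" for k, folded A_ev_eq]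
  and form_subspace_A_od = form_subspace_eigenforms[of k "- ((- \<i>) ^ k)" for k, folded A_od_eq]

lemma A_ev_od_unique:
  assumes "\<beta> + \<gamma> = \<beta>' + \<gamma>'" "\<beta> \<in> A_ev atlas J k" "\<beta>' \<in> A_ev atlas J k"
    "\<gamma> \<in> A_od atlas J k" "\<gamma>' \<in> A_od atlas J k"
  shows "\<beta> = \<beta>'" "\<gamma> = \<gamma>'"
proof -
  have eq: "\<beta> - \<beta>' = \<gamma>' - \<gamma>" using assms(1) by (simp add: algebra_simps)
  have "\<beta> - \<beta>' \<in> A_ev atlas J k" "\<gamma>' - \<gamma> \<in> A_od atlas J k"
    using assms form_subspace_diff form_subspace_A_ev form_subspace_A_od by blast+
  then have "\<beta> - \<beta>' = 0"
    using eigenforms_disjoint[of "\<beta> - \<beta>'" k "(- \<i>) ^ k"] by (simp add: A_ev_eq A_od_eq eq)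
  then show "\<beta> = \<beta>'" "\<gamma> = \<gamma>'" using eq by simp_all
qed

lemma
  assumes "\<beta> \<in> A_ev atlas J k" "\<gamma> \<in> A_od atlas J k"
  shows ev_part_sum: "ev_part atlas J k (\<beta> + \<gamma>) = \<beta>"
    and od_part_sum: "od_part atlas J k (\<beta> + \<gamma>) = \<gamma>"
  unfolding ev_part_def od_part_def
  by (rule the_equality; use assms A_ev_od_unique in metis)+

lemma
  assumes \<alpha>: "\<alpha> \<in> A atlas k"
  shows ev_part_eq: "ev_part atlas J k \<alpha> = scale_form (1 / 2) (\<alpha> + scale_form (\<i> ^ k) (act J \<alpha>))"
    and od_part_eq: "od_part atlas J k \<alpha> = scale_form (1 / 2) (\<alpha> + scale_form (- (\<i> ^ k)) (act J \<alpha>))"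
    and ev_part_in: "ev_part atlas J k \<alpha> \<in> A_ev atlas J k"
    and od_part_in: "od_part atlas J k \<alpha> \<in> A_od atlas J k"
    and ev_part_od_part: "ev_part atlas J k \<alpha> + od_part atlas J k \<alpha> = \<alpha>"
proof -
  let ?e = "scale_form (1 / 2) (\<alpha> + scale_form (\<i> ^ k) (act J \<alpha>))"
  let ?o = "scale_form (1 / 2) (\<alpha> + scale_form (- (\<i> ^ k)) (act J \<alpha>))"
  \<comment> \<open>\<open>\<i> ^ k\<close> is the inverse of the even eigenvalue
    \<open>(- \<i>) ^ k\<close>, and J squares to \<open>(-1) ^ k\<close>. Hence J multiplies
    \<open>?e\<close> by \<open>(- \<i>) ^ k\<close> and \<open>?o\<close> by its negative.\<close>
  have 1: "(- \<i>) ^ k = \<i> ^ k * (-1) ^ k" "\<i> ^ k * (\<i> ^ k * (-1) ^ k) = 1"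
    by (simp_all flip: power_mult_distrib)
  have e: "?e \<in> A_ev atlas J k" and o: "?o \<in> A_od atlas J k"
    unfolding A_ev_eq A_od_eq eigenforms_def using \<alpha>
    by (auto intro!: A_scale A_add A_act_J
        simp: act_add act_scale act_J_J[OF \<alpha>] scale_form_simps mult_ac 1 add.commute)
  have sum: "?e + ?o = \<alpha>" by (intro ext) (simp add: scale_form_def field_simps)
  from ev_part_sum[OF e o] od_part_sum[OF e o]
  show e': "ev_part atlas J k \<alpha> = ?e" and o': "od_part atlas J k \<alpha> = ?o"
    unfolding sum .
  show "ev_part atlas J k \<alpha> \<in> A_ev atlas J k" "od_part atlas J k \<alpha> \<in> A_od atlas J k"
    "ev_part atlas J k \<alpha> + od_part atlas J k \<alpha> = \<alpha>"
    unfolding e' o' by (rule e o sum)+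
qed

end


section \<open>Quotients\<close>

lemma coset_eq_iff:
  assumes "form_subspace I"
  shows "coset I \<alpha> = coset I \<beta> \<longleftrightarrow> \<alpha> - \<beta> \<in> I"
proof
  assume "coset I \<alpha> = coset I \<beta>"
  moreover have "\<alpha> \<in> coset I \<alpha>" using form_subspaceD(1)[OF assms] by (simp add: coset_def)
  ultimately show "\<alpha> - \<beta> \<in> I" by (simp add: coset_def)
next
  assume *: "\<alpha> - \<beta> \<in> I"
  have "\<gamma> - \<alpha> \<in> I \<longleftrightarrow> \<gamma> - \<beta> \<in> I" for \<gamma>
    using form_subspaceD(2)[OF assms, of "\<gamma> - \<alpha>" "\<alpha> - \<beta>"]
      form_subspace_diff[OF assms, of "\<gamma> - \<beta>" "\<alpha> - \<beta>"] * by auto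
  then show "coset I \<alpha> = coset I \<beta>" by (simp add: coset_def)
qed

lemma coset_add:
  assumes "form_subspace I"
  shows "coset I \<alpha> + coset I \<beta> = coset I (\<alpha> + \<beta>)"
proof (intro equalityI subsetI)
  fix \<gamma> assume "\<gamma> \<in> coset I \<alpha> + coset I \<beta>"
  then obtain \<alpha>' \<beta>' where \<gamma>: "\<gamma> = \<alpha>' + \<beta>'" "\<alpha>' - \<alpha> \<in> I" "\<beta>' - \<beta> \<in> I"
    by (auto simp: set_plus_def coset_def)
  show "\<gamma> \<in> coset I (\<alpha> + \<beta>)"
    using form_subspaceD(2)[OF assms \<gamma>(2,3)]
    unfolding coset_def \<gamma>(1) mem_Collect_eq add_diff_add .
next
  fix \<gamma> assume "\<gamma> \<in> coset I (\<alpha> + \<beta>)"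
  then have "\<gamma> - \<alpha> - \<beta> \<in> I" by (simp add: coset_def diff_diff_eq)
  moreover have "\<alpha> \<in> coset I \<alpha>" using form_subspaceD(1)[OF assms] by (simp add: coset_def)
  moreover have "\<gamma> = \<alpha> + (\<gamma> - \<alpha>)" by simp
  ultimately show "\<gamma> \<in> coset I \<alpha> + coset I \<beta>"
    by (metis (no_types, lifting) coset_def mem_Collect_eq set_plus_intro)
qed

lemma coset_scale_coset:
  assumes "form_subspace I"
  shows "coset_scale I a (coset I \<alpha>) = coset I (scale_form a \<alpha>)"
proof (intro equalityI subsetI)
  fix \<gamma> assume "\<gamma> \<in> coset_scale I a (coset I \<alpha>)"
  then obtain \<alpha>' \<iota> where \<gamma>: "\<gamma> = scale_form a \<alpha>' + \<iota>" "\<alpha>' - \<alpha> \<in> I" "\<iota> \<in> I"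
    by (auto simp: coset_scale_def coset_def)
  have "\<gamma> - scale_form a \<alpha> = scale_form a (\<alpha>' - \<alpha>) + \<iota>"
    by (intro ext) (simp add: \<gamma>(1) scale_form_def algebra_simps)
  then show "\<gamma> \<in> coset I (scale_form a \<alpha>)"
    using form_subspaceD(2,3)[OF assms] \<gamma>(2,3) by (simp add: coset_def)
next
  fix \<gamma> assume "\<gamma> \<in> coset I (scale_form a \<alpha>)"
  then have "\<gamma> - scale_form a \<alpha> \<in> I" by (simp add: coset_def)
  moreover have "\<alpha> \<in> coset I \<alpha>" using form_subspaceD(1)[OF assms] by (simp add: coset_def)
  moreover have "\<gamma> = scale_form a \<alpha> + (\<gamma> - scale_form a \<alpha>)" by simp
  ultimately show "\<gamma> \<in> coset_scale I a (coset I \<alpha>)"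
    unfolding coset_scale_def by blast
qed

text \<open>Elements of a quotient are cosets, so the induced map picks a representative in
  \<open>Z\<close>. Two such representatives differ by an element of both \<open>Z\<close> and
  \<open>I\<close>, which is why the second condition on \<open>L\<close> concerns exactly these
  forms.\<close>

lemma quot_linear_induced:
  assumes Z: "form_subspace Z" and I: "form_subspace I" and I': "form_subspace I'"
    and L: "\<And>\<alpha>. \<alpha> \<in> Z \<Longrightarrow> L \<alpha> \<in> Z'" "\<And>\<alpha>. \<alpha> \<in> Z \<Longrightarrow> \<alpha> \<in> I \<Longrightarrow> L \<alpha> \<in> I'"
    and add: "\<And>\<alpha> \<beta>. \<alpha> \<in> Z \<Longrightarrow> \<beta> \<in> Z \<Longrightarrow> L (\<alpha> + \<beta>) = L \<alpha> + L \<beta>"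
    and scale: "\<And>a \<alpha>. \<alpha> \<in> Z \<Longrightarrow> L (scale_form a \<alpha>) = scale_form a (L \<alpha>)"
  shows "\<exists>F. quot_linear Z I Z' I' F \<and> (\<forall>\<alpha>\<in>Z. F (coset I \<alpha>) = coset I' (L \<alpha>))"
proof -
  define F where "F C = coset I' (L (SOME \<alpha>. \<alpha> \<in> Z \<and> C = coset I \<alpha>))" for C
  have diff: "L (\<alpha> - \<beta>) = L \<alpha> - L \<beta>" if "\<alpha> \<in> Z" "\<beta> \<in> Z" for \<alpha> \<beta>
    using add[OF form_subspace_diff[OF Z that] that(2)] by (simp add: algebra_simps)
  have F: "F (coset I \<alpha>) = coset I' (L \<alpha>)" if "\<alpha> \<in> Z" for \<alpha>
  proof -
    define \<beta> where "\<beta> = (SOME \<beta>. \<beta> \<in> Z \<and> coset I \<alpha> = coset I \<beta>)"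
    have \<beta>: "\<beta> \<in> Z \<and> coset I \<alpha> = coset I \<beta>"
      unfolding \<beta>_def by (rule someI[of _ \<alpha>]) (use that in simp)
    then have "\<alpha> - \<beta> \<in> I" using coset_eq_iff[OF I] by blast
    then have "L \<alpha> - L \<beta> \<in> I'"
      using L(2)[OF form_subspace_diff[OF Z that]] \<beta> diff[OF that] by simp
    then have "coset I' (L \<alpha>) = coset I' (L \<beta>)" using coset_eq_iff[OF I'] by blast
    then show ?thesis by (simp add: F_def \<beta>_def)
  qed
  have "quot_linear Z I Z' I' F"
    unfolding quot_linear_def quot_def
  proof (intro conjI ballI allI; elim imageE; hypsubst)
    fix \<alpha> assume \<alpha>: "\<alpha> \<in> Z"
    show "F (coset I \<alpha>) \<in> coset I' ` Z'" using F L(1) \<alpha> by simp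
    show "F (coset_scale I a (coset I \<alpha>)) = coset_scale I' a (F (coset I \<alpha>))" for a
      using \<alpha> form_subspaceD(3)[OF Z \<alpha>]
      by (simp add: coset_scale_coset[OF I] coset_scale_coset[OF I'] F scale)
    fix \<beta> assume \<beta>: "\<beta> \<in> Z"
    show "F (coset I \<alpha> + coset I \<beta>) = F (coset I \<alpha>) + F (coset I \<beta>)"
      using \<alpha> \<beta> form_subspaceD(2)[OF Z \<alpha> \<beta>] by (simp add: coset_add[OF I] coset_add[OF I'] F add)
  qed
  with F show ?thesis by blast
qed


section \<open>Parity in Bott-Chern cohomology\<close>

context almost_complex
begin

section \<open>Signs of the twisted derivative, and the spaces B\<close>

lemma A_ext_d_act_J: "\<alpha> \<in> A atlas k \<Longrightarrow> ext_d (act J \<alpha>) \<in> A atlas (Suc k)"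
  by (intro A_ext_d A_act_J)

text \<open>The exponent is \<open>Suc k\<close> because the inverse of J acts after d, on forms of
  degree k + 1.\<close>

lemma ext_dc_eq:
  assumes "\<alpha> \<in> A atlas k"
  shows "ext_dc J \<alpha> = scale_form ((-1) ^ Suc k) (act J (ext_d (act J \<alpha>)))"
  unfolding ext_dc_def by (rule act_uminus[OF A_ext_d_act_J[OF assms]])

lemma A_ext_dc: "\<alpha> \<in> A atlas k \<Longrightarrow> ext_dc J \<alpha> \<in> A atlas (Suc k)"
  by (simp add: ext_dc_eq A_scale A_act_J A_ext_d_act_J)

lemma ext_dc_add:
  assumes "\<alpha> \<in> A atlas k" "\<beta> \<in> A atlas k"
  shows "ext_dc J (\<alpha> + \<beta>) = ext_dc J \<alpha> + ext_dc J \<beta>"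
  using assms by (simp add: ext_dc_def act_add ext_d_add[OF A_act_J A_act_J])

lemma ext_dc_scale:
  assumes "\<alpha> \<in> A atlas k"
  shows "ext_dc J (scale_form a \<alpha>) = scale_form a (ext_dc J \<alpha>)"
  using assms by (simp add: ext_dc_def act_scale ext_d_scale[OF A_act_J])

lemma ddc_eq:
  assumes "\<alpha> \<in> A atlas k"
  shows "ext_d (ext_dc J \<alpha>) = scale_form ((-1) ^ Suc k) (ext_d (act J (ext_d (act J \<alpha>))))"
  unfolding ext_dc_eq[OF assms]
  by (rule ext_d_scale[OF A_act_J[OF A_ext_d_act_J[OF assms]]])

lemma ddc_add:
  assumes "\<alpha> \<in> A atlas k" "\<beta> \<in> A atlas k"
  shows "ext_d (ext_dc J (\<alpha> + \<beta>)) = ext_d (ext_dc J \<alpha>) + ext_d (ext_dc J \<beta>)"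
  using assms by (simp add: ext_dc_add ext_d_add[OF A_ext_dc A_ext_dc])

lemma ddc_scale:
  assumes "\<alpha> \<in> A atlas k"
  shows "ext_d (ext_dc J (scale_form a \<alpha>)) = scale_form a (ext_d (ext_dc J \<alpha>))"
  using assms by (simp add: ext_dc_scale ext_d_scale[OF A_ext_dc])

text \<open>On degree k the first term carries the sign \<open>(-1) ^ Suc k\<close>, and the second,
  where the twisted derivative starts in degree k + 1, the opposite one. The sum therefore vanishes
  exactly when the two unsigned expressions agree.\<close>

lemma B_iff:
  "\<alpha> \<in> B atlas J k \<longleftrightarrow> \<alpha> \<in> A atlas k \<and>
    ext_d (act J (ext_d (act J \<alpha>))) = act J (ext_d (act J (ext_d \<alpha>)))"
proof -
  have "ext_d (ext_dc J \<alpha>) + ext_dc J (ext_d \<alpha>) = 0 \<longleftrightarrow>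
      ext_d (act J (ext_d (act J \<alpha>))) = act J (ext_d (act J (ext_d \<alpha>)))" if \<alpha>: "\<alpha> \<in> A atlas k"
  proof -
    have "ext_d (ext_dc J \<alpha>) + ext_dc J (ext_d \<alpha>) = scale_form ((-1) ^ Suc k)
        (ext_d (act J (ext_d (act J \<alpha>))) - act J (ext_d (act J (ext_d \<alpha>))))"
      unfolding ddc_eq[OF \<alpha>] ext_dc_eq[OF A_ext_d[OF \<alpha>]]
      by (intro ext) (simp add: scale_form_def algebra_simps)
    moreover have "scale_form ((-1) ^ Suc k) \<beta> = 0 \<longleftrightarrow> \<beta> = 0" for \<beta> :: "('a, 'e) form"
      by (simp add: scale_form_def fun_eq_iff)
    ultimately show ?thesis by simp
  qed
  then show ?thesis by (auto simp: B_def)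
qed

lemma form_subspace_B: "form_subspace (B atlas J k)"
proof -
  have "\<alpha> + \<beta> \<in> B atlas J k" if "\<alpha> \<in> B atlas J k" "\<beta> \<in> B atlas J k" for \<alpha> \<beta>
  proof -
    have \<alpha>: "\<alpha> \<in> A atlas k" and \<beta>: "\<beta> \<in> A atlas k" using that by (simp_all add: B_def)
    have "ext_d (ext_dc J (\<alpha> + \<beta>)) + ext_dc J (ext_d (\<alpha> + \<beta>)) =
        (ext_d (ext_dc J \<alpha>) + ext_dc J (ext_d \<alpha>)) + (ext_d (ext_dc J \<beta>) + ext_dc J (ext_d \<beta>))"
      unfolding ddc_add[OF \<alpha> \<beta>] ext_d_add[OF \<alpha> \<beta>] ext_dc_add[OF A_ext_d[OF \<alpha>] A_ext_d[OF \<beta>]]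
      by (simp only: add_ac)
    then show ?thesis using that A_add[OF \<alpha> \<beta>] by (simp add: B_def)
  qed
  moreover have "scale_form a \<alpha> \<in> B atlas J k" if "\<alpha> \<in> B atlas J k" for a \<alpha>
  proof -
    have \<alpha>: "\<alpha> \<in> A atlas k" using that by (simp add: B_def)
    show ?thesis
      using that \<alpha> unfolding B_def
      by (simp add: A_scale ddc_scale[OF \<alpha>] ext_d_scale[OF \<alpha>] ext_dc_scale[OF A_ext_d[OF \<alpha>]]
          scale_form_simps(5) flip: scale_form_simps(1))
  qed
  moreover have "0 \<in> B atlas J k"
    by (simp add: B_iff A_zero act_zero ext_d_zero)
  ultimately show ?thesis by (simp add: form_subspace_def)
qed

text \<open>Applying J to the equation dJdJ = JdJd on \<open>\<alpha>\<close> turns its right side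
  into \<open>(-1) ^ k\<close> times dJd\<open>\<alpha>\<close>, J squaring to that sign in degree k
  + 2. Replacing \<open>\<alpha>\<close> by J\<open>\<alpha>\<close> in dJdJ gives the same
  form.\<close>

lemma B_act_J:
  assumes "\<alpha> \<in> B atlas J k"
  shows "act J \<alpha> \<in> B atlas J k"
proof -
  have \<alpha>: "\<alpha> \<in> A atlas k"
    and eq: "ext_d (act J (ext_d (act J \<alpha>))) = act J (ext_d (act J (ext_d \<alpha>)))"
    using assms by (simp_all add: B_iff)
  have "act J (ext_d (act J (ext_d (act J \<alpha>)))) = scale_form ((-1) ^ k) (ext_d (act J (ext_d \<alpha>)))"
    unfolding eq using act_J_J[OF A_ext_d_act_J[OF A_ext_d[OF \<alpha>]]] by simp
  also have "\<dots> = ext_d (act J (ext_d (act J (act J \<alpha>))))"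
    using \<alpha> by (simp add: act_J_J[OF \<alpha>] ext_d_scale[OF \<alpha>] act_scale
        ext_d_scale[OF A_act_J[OF A_ext_d[OF \<alpha>]]])
  finally show ?thesis using \<alpha> by (simp add: B_iff A_act_J)
qed

lemma B_ev_od:
  assumes "\<alpha> \<in> B atlas J k"
  shows "ev_part atlas J k \<alpha> \<in> B atlas J k" "od_part atlas J k \<alpha> \<in> B atlas J k"
proof -
  have \<alpha>: "\<alpha> \<in> A atlas k" using assms by (simp add: B_def)
  show "ev_part atlas J k \<alpha> \<in> B atlas J k" "od_part atlas J k \<alpha> \<in> B atlas J k"
    unfolding ev_part_eq[OF \<alpha>] od_part_eq[OF \<alpha>]
    by (intro form_subspaceD(2,3)[OF form_subspace_B] assms B_act_J)+
qed

text \<open>Let c be the eigenvalue of \<open>\<alpha>\<close>. Then dJdJ\<open>\<alpha>\<close> is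
  c dJd\<open>\<alpha>\<close>, while J maps it to JJdJd\<open>\<alpha>\<close>, which is
  \<open>(-1) ^ k\<close> times dJd\<open>\<alpha>\<close>. So J acts on it by
  \<open>(-1) ^ k / c\<close>. The sign \<open>s\<close> distinguishes even (1) from odd
  (-1).\<close>

lemma ddc_eigenforms:
  assumes "\<alpha> \<in> B atlas J k" "\<alpha> \<in> eigenforms k (s * (- \<i>) ^ k)" "s * s = 1"
  shows "ext_d (ext_dc J \<alpha>) \<in> eigenforms (Suc (Suc k)) (- s * (- \<i>) ^ Suc (Suc k))"
proof -
  have \<alpha>: "\<alpha> \<in> A atlas k"
    and eq: "ext_d (act J (ext_d (act J \<alpha>))) = act J (ext_d (act J (ext_d \<alpha>)))"
    using assms(1) by (simp_all add: B_iff)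
  let ?\<gamma> = "ext_d (act J (ext_d \<alpha>))"
  have J\<alpha>: "act J \<alpha> = scale_form (s * (- \<i>) ^ k) \<alpha>"
    using assms(2) by (simp add: eigenforms_def)
  have 1: "ext_d (act J (ext_d (act J \<alpha>))) = scale_form (s * (- \<i>) ^ k) ?\<gamma>"
    unfolding J\<alpha> by (simp add: ext_d_scale[OF \<alpha>] act_scale ext_d_scale[OF A_act_J[OF A_ext_d[OF \<alpha>]]])
  have "act J (ext_d (act J (ext_d (act J \<alpha>)))) = scale_form ((-1) ^ k) ?\<gamma>"
    unfolding eq using act_J_J[OF A_ext_d_act_J[OF A_ext_d[OF \<alpha>]]] by simp
  \<comment> \<open>Identifies \<open>(-1) ^ k / c\<close>. Numerically it equals c again, but
    \<open>(- \<i>) ^ k\<close> changes sign when the degree rises by 2, so the same scalar stands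
    for the opposite parity.\<close>
  moreover have "(- s * (- \<i>) ^ Suc (Suc k)) * (s * (- \<i>) ^ k) = (-1) ^ k"
  proof -
    have "(- s * (- \<i>) ^ Suc (Suc k)) * (s * (- \<i>) ^ k) = (s * s) * ((- \<i>) ^ k * (- \<i>) ^ k)"
      by (simp add: mult_ac)
    also have "(- \<i>) ^ k * (- \<i>) ^ k = (-1) ^ k" by (simp flip: power_mult_distrib)
    finally show ?thesis using assms(3) by simp
  qed
  ultimately have "act J (ext_d (act J (ext_d (act J \<alpha>)))) =
      scale_form (- s * (- \<i>) ^ Suc (Suc k)) (ext_d (act J (ext_d (act J \<alpha>))))"
    unfolding 1 scale_form_simps by simp
  then have "ext_d (act J (ext_d (act J \<alpha>))) \<in> eigenforms (Suc (Suc k)) (- s * (- \<i>) ^ Suc (Suc k))"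
    using \<alpha> by (simp add: eigenforms_def A_ext_d A_act_J)
  then show ?thesis
    unfolding ddc_eq[OF \<alpha>] by (rule form_subspaceD(3)[OF form_subspace_eigenforms])
qed

lemma ddc_ev: "\<alpha> \<in> B atlas J k \<Longrightarrow> \<alpha> \<in> A_ev atlas J k \<Longrightarrow> ext_d (ext_dc J \<alpha>) \<in> A_od atlas J (Suc (Suc k))"
  using ddc_eigenforms[of \<alpha> k 1] by (simp add: A_ev_eq A_od_eq)

lemma ddc_od: "\<alpha> \<in> B atlas J k \<Longrightarrow> \<alpha> \<in> A_od atlas J k \<Longrightarrow> ext_d (ext_dc J \<alpha>) \<in> A_ev atlas J (Suc (Suc k))"
  using ddc_eigenforms[of \<alpha> k "-1"] by (simp add: A_ev_eq A_od_eq)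

text \<open>J is invertible, so it can be stripped from the twisted derivative. Where both
  derivatives vanish, each term of the condition defining \<open>B\<close> vanishes too.\<close>

lemma BC_cocycles_iff:
  "\<alpha> \<in> BC_cocycles atlas J k \<longleftrightarrow> \<alpha> \<in> A atlas k \<and> ext_d \<alpha> = 0 \<and> ext_d (act J \<alpha>) = 0"
proof -
  have "ext_dc J \<alpha> = 0 \<longleftrightarrow> ext_d (act J \<alpha>) = 0" if \<alpha>: "\<alpha> \<in> A atlas k"
  proof
    assume "ext_dc J \<alpha> = 0"
    then have "scale_form ((-1) ^ Suc k) (act J (act J (ext_d (act J \<alpha>)))) = 0"
      by (simp only: ext_dc_eq[OF \<alpha>] act_scale[symmetric] act_zero)
    then show "ext_d (act J \<alpha>) = 0"
      by (simp add: act_J_J[OF A_ext_d_act_J[OF \<alpha>]] scale_form_simps flip: power_mult_distrib)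
  qed (simp add: ext_dc_def act_zero)
  then show ?thesis
    by (auto simp: BC_cocycles_def B_def ext_d_zero ext_dc_def act_zero)
qed

section \<open>Cocycles and coboundaries under the parity projections\<close>

lemma BC_cocycles_A: "\<alpha> \<in> BC_cocycles atlas J k \<Longrightarrow> \<alpha> \<in> A atlas k"
  by (simp add: BC_cocycles_iff)

lemma form_subspace_BC_cocycles: "form_subspace (BC_cocycles atlas J k)"
  unfolding form_subspace_def
  by (auto simp: BC_cocycles_iff A_zero A_add A_scale act_zero act_add act_scale ext_d_zero
      scale_form_simps ext_d_add[of _ atlas k] ext_d_scale[of _ atlas k] A_act_J)

lemma BC_cocycles_act_J: "\<alpha> \<in> BC_cocycles atlas J k \<Longrightarrow> act J \<alpha> \<in> BC_cocycles atlas J k"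
  by (auto simp: BC_cocycles_iff A_act_J act_J_J ext_d_scale scale_form_simps)

lemma
  assumes "\<alpha> \<in> BC_cocycles atlas J k"
  shows ev_part_BC_cocycles: "ev_part atlas J k \<alpha> \<in> BC_cocycles_ev atlas J k"
    and od_part_BC_cocycles: "od_part atlas J k \<alpha> \<in> BC_cocycles_od atlas J k"
proof -
  have \<alpha>: "\<alpha> \<in> A atlas k" using assms by (rule BC_cocycles_A)
  have "ev_part atlas J k \<alpha> \<in> BC_cocycles atlas J k" "od_part atlas J k \<alpha> \<in> BC_cocycles atlas J k"
    unfolding ev_part_eq[OF \<alpha>] od_part_eq[OF \<alpha>]
    by (intro form_subspaceD(2,3)[OF form_subspace_BC_cocycles] assms BC_cocycles_act_J)+
  then show "ev_part atlas J k \<alpha> \<in> BC_cocycles_ev atlas J k" "od_part atlas J k \<alpha> \<in> BC_cocycles_od atlas J k"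
    using ev_part_in[OF \<alpha>] od_part_in[OF \<alpha>] by (simp_all add: BC_cocycles_ev_def BC_cocycles_od_def)
qed

lemma BC_cocycles_dR_cocycles: "\<alpha> \<in> BC_cocycles atlas J k \<Longrightarrow> \<alpha> \<in> dR_cocycles atlas k"
  by (simp add: BC_cocycles_iff dR_cocycles_def)

text \<open>The family \<open>S\<close> is arbitrary so that one proof covers \<open>B\<close> and
  its even and odd parts, the sources of the three coboundary spaces.\<close>

lemma form_subspace_ddc_image:
  assumes "\<And>j. form_subspace (S j)" "\<And>j. S j \<subseteq> A atlas j"
  shows "form_subspace (ddc_image J S k)"
proof (cases "k < 2")
  case True
  then show ?thesis by (auto simp: ddc_image_def form_subspace_def scale_form_simps)
next
  case False
  define j where "j = k - 2"
  note S = form_subspaceD[OF assms(1)[of j]] and SA = subsetD[OF assms(2)[of j]]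
  have "ext_d (ext_dc J 0) = 0" by (simp add: ext_dc_def act_zero ext_d_zero)
  then have "0 \<in> (\<lambda>\<eta>. ext_d (ext_dc J \<eta>)) ` S j" using S(1) by (metis image_eqI)
  moreover have "ext_d (ext_dc J \<alpha>) + ext_d (ext_dc J \<beta>) \<in> (\<lambda>\<eta>. ext_d (ext_dc J \<eta>)) ` S j"
    if "\<alpha> \<in> S j" "\<beta> \<in> S j" for \<alpha> \<beta>
    using ddc_add[OF SA SA, OF that] S(2)[OF that] by (metis image_eqI)
  moreover have "scale_form a (ext_d (ext_dc J \<alpha>)) \<in> (\<lambda>\<eta>. ext_d (ext_dc J \<eta>)) ` S j"
    if "\<alpha> \<in> S j" for a \<alpha>
    using ddc_scale[OF SA, OF that] S(3)[OF that] by (metis image_eqI)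
  ultimately show ?thesis
    using False by (auto simp: ddc_image_def form_subspace_def j_def)
qed

lemma form_subspace_Int: "form_subspace V \<Longrightarrow> form_subspace W \<Longrightarrow> form_subspace (V \<inter> W)"
  by (auto simp: form_subspace_def)

lemma B_subset: "B atlas J k \<subseteq> A atlas k"
  by (auto simp: B_def)

lemma form_subspace_BC_coboundaries: "form_subspace (BC_coboundaries atlas J k)"
  unfolding BC_coboundaries_def
  by (intro form_subspace_ddc_image form_subspace_B B_subset)

lemma form_subspace_BC_coboundaries_ev: "form_subspace (BC_coboundaries_ev atlas J k)"
  unfolding BC_coboundaries_ev_def
  by (intro form_subspace_ddc_image form_subspace_Int form_subspace_B form_subspace_A_od
      le_infI1 B_subset)

lemma form_subspace_BC_coboundaries_od: "form_subspace (BC_coboundaries_od atlas J k)"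
  unfolding BC_coboundaries_od_def
  by (intro form_subspace_ddc_image form_subspace_Int form_subspace_B form_subspace_A_ev
      le_infI1 B_subset)

lemma BC_coboundaries_ev_subset: "BC_coboundaries_ev atlas J k \<subseteq> BC_coboundaries atlas J k"
  and BC_coboundaries_od_subset: "BC_coboundaries_od atlas J k \<subseteq> BC_coboundaries atlas J k"
  by (auto simp: BC_coboundaries_ev_def BC_coboundaries_od_def BC_coboundaries_def ddc_image_def)

lemma
  assumes "\<alpha> \<in> BC_coboundaries atlas J k"
  shows ev_part_BC_coboundaries: "ev_part atlas J k \<alpha> \<in> BC_coboundaries_ev atlas J k"
    and od_part_BC_coboundaries: "od_part atlas J k \<alpha> \<in> BC_coboundaries_od atlas J k"
proof -
  have "ev_part atlas J k \<alpha> \<in> BC_coboundaries_ev atlas J k \<and>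
    od_part atlas J k \<alpha> \<in> BC_coboundaries_od atlas J k"
  proof (cases "k < 2")
    case True
    \<comment> \<open>Written as a sum of an even and an odd form, to match
      \<open>ev_part_sum\<close> and \<open>od_part_sum\<close>.\<close>
    then have "\<alpha> = 0 + 0" using assms by (simp add: BC_coboundaries_def ddc_image_def)
    then have "ev_part atlas J k \<alpha> = 0" "od_part atlas J k \<alpha> = 0"
      using ev_part_sum od_part_sum form_subspaceD(1)[OF form_subspace_A_ev]
        form_subspaceD(1)[OF form_subspace_A_od] by blast+
    then show ?thesis
      using form_subspaceD(1)[OF form_subspace_BC_coboundaries_ev]
        form_subspaceD(1)[OF form_subspace_BC_coboundaries_od] by simp
  next
    case False
    define j where "j = k - 2"
    have k: "k = Suc (Suc j)" using False by (simp add: j_def)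
    obtain \<eta> where \<eta>: "\<eta> \<in> B atlas J j" "\<alpha> = ext_d (ext_dc J \<eta>)"
      using assms False by (auto simp: BC_coboundaries_def ddc_image_def j_def)
    have \<eta>A: "\<eta> \<in> A atlas j" using \<eta>(1) by (simp add: B_def)
    let ?e = "ev_part atlas J j \<eta>" and ?o = "od_part atlas J j \<eta>"
    have e: "?e \<in> B atlas J j" "?e \<in> A_ev atlas J j" and o: "?o \<in> B atlas J j" "?o \<in> A_od atlas J j"
      using B_ev_od[OF \<eta>(1)] ev_part_in[OF \<eta>A] od_part_in[OF \<eta>A] by simp_all
    have "ext_d (ext_dc J (?e + ?o)) = ext_d (ext_dc J ?e) + ext_d (ext_dc J ?o)"
      using e(1) o(1) by (intro ddc_add[of _ j]) (simp_all add: B_def)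
    \<comment> \<open>The summands are interchanged: the image of the odd part is even and has to
      stand first for \<open>ev_part_sum\<close>.\<close>
    then have sum: "\<alpha> = ext_d (ext_dc J ?o) + ext_d (ext_dc J ?e)"
      unfolding ev_part_od_part[OF \<eta>A] \<eta>(2) by (simp only: add.commute)
    have "ev_part atlas J k \<alpha> = ext_d (ext_dc J ?o)" "od_part atlas J k \<alpha> = ext_d (ext_dc J ?e)"
      unfolding sum k using ddc_od[OF o] ddc_ev[OF e] by (simp_all add: ev_part_sum od_part_sum)
    then show ?thesis
      using False e o
      by (auto simp: BC_coboundaries_ev_def BC_coboundaries_od_def ddc_image_def simp flip: j_def)
  qed
  then show "ev_part atlas J k \<alpha> \<in> BC_coboundaries_ev atlas J k"
    "od_part atlas J k \<alpha> \<in> BC_coboundaries_od atlas J k" by simp_all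
qed

lemma form_subspace_dR_coboundaries: "form_subspace (dR_coboundaries atlas k)"
proof (cases k)
  case 0
  then show ?thesis by (auto simp: dR_coboundaries_def form_subspace_def scale_form_simps)
next
  case (Suc j)
  have "0 \<in> ext_d ` A atlas j" using ext_d_zero A_zero by (metis image_eqI)
  moreover have "ext_d \<alpha> + ext_d \<beta> \<in> ext_d ` A atlas j" if "\<alpha> \<in> A atlas j" "\<beta> \<in> A atlas j" for \<alpha> \<beta>
    using ext_d_add[OF that] A_add[OF that] by (metis image_eqI)
  moreover have "scale_form a (ext_d \<alpha>) \<in> ext_d ` A atlas j" if "\<alpha> \<in> A atlas j" for a \<alpha>
    using ext_d_scale[OF that] A_scale[OF that] by (metis image_eqI)
  ultimately show ?thesis
    using Suc by (auto simp: dR_coboundaries_def form_subspace_def)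
qed

text \<open>The twisted derivative of \<open>\<eta>\<close> is a primitive of degree k - 1.\<close>

lemma BC_coboundaries_dR_coboundaries: "BC_coboundaries atlas J k \<subseteq> dR_coboundaries atlas k"
proof (cases "k < 2")
  case True
  then show ?thesis
    using form_subspaceD(1)[OF form_subspace_dR_coboundaries]
    by (simp add: BC_coboundaries_def ddc_image_def)
next
  case False
  then have "k - 1 = Suc (k - 2)" by simp
  then show ?thesis
    using False A_ext_dc by (auto simp: BC_coboundaries_def ddc_image_def dR_coboundaries_def B_def)
qed

section \<open>Linearity of the parity projections and the induced maps on cohomology\<close>

lemma
  assumes \<alpha>: "\<alpha> \<in> A atlas k" and \<beta>: "\<beta> \<in> A atlas k"
  shows ev_part_add: "ev_part atlas J k (\<alpha> + \<beta>) = ev_part atlas J k \<alpha> + ev_part atlas J k \<beta>"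
    and od_part_add: "od_part atlas J k (\<alpha> + \<beta>) = od_part atlas J k \<alpha> + od_part atlas J k \<beta>"
  unfolding ev_part_eq[OF \<alpha>] ev_part_eq[OF \<beta>] ev_part_eq[OF A_add[OF \<alpha> \<beta>]]
    od_part_eq[OF \<alpha>] od_part_eq[OF \<beta>] od_part_eq[OF A_add[OF \<alpha> \<beta>]]
  by (simp_all add: act_add scale_form_simps(1) add_ac)

lemma
  assumes \<alpha>: "\<alpha> \<in> A atlas k"
  shows ev_part_scale: "ev_part atlas J k (scale_form a \<alpha>) = scale_form a (ev_part atlas J k \<alpha>)"
    and od_part_scale: "od_part atlas J k (scale_form a \<alpha>) = scale_form a (od_part atlas J k \<alpha>)"
  unfolding ev_part_eq[OF \<alpha>] ev_part_eq[OF A_scale[OF \<alpha>]]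
    od_part_eq[OF \<alpha>] od_part_eq[OF A_scale[OF \<alpha>]]
  by (simp_all add: act_scale scale_form_simps(1,3) mult_ac)

text \<open>The even and odd quotients consist of cosets of other subspaces than the full one and so
  are not literally subsets of it. The direct sum is therefore expressed by two linear maps, induced
  by the projections, that are jointly bijective onto the product.\<close>

lemma Bott_Chern_parity_decomposition:
  "\<exists>F_ev F_od.
     quot_linear (BC_cocycles atlas J k) (BC_coboundaries atlas J k)
       (BC_cocycles_ev atlas J k) (BC_coboundaries_ev atlas J k) F_ev \<and>
     quot_linear (BC_cocycles atlas J k) (BC_coboundaries atlas J k)
       (BC_cocycles_od atlas J k) (BC_coboundaries_od atlas J k) F_od \<and>
     (\<forall>\<alpha>\<in>BC_cocycles atlas J k.
        F_ev (coset (BC_coboundaries atlas J k) \<alpha>) =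
          coset (BC_coboundaries_ev atlas J k) (ev_part atlas J k \<alpha>) \<and>
        F_od (coset (BC_coboundaries atlas J k) \<alpha>) =
          coset (BC_coboundaries_od atlas J k) (od_part atlas J k \<alpha>)) \<and>
     bij_betw (\<lambda>C. (F_ev C, F_od C)) (H_BC atlas J k) (H_BC_ev atlas J k \<times> H_BC_od atlas J k)"
proof -
  let ?Z = "BC_cocycles atlas J k" and ?I = "BC_coboundaries atlas J k"
  let ?Ze = "BC_cocycles_ev atlas J k" and ?Ie = "BC_coboundaries_ev atlas J k"
  let ?Zo = "BC_cocycles_od atlas J k" and ?Io = "BC_coboundaries_od atlas J k"
  let ?e = "ev_part atlas J k" and ?o = "od_part atlas J k"
  note ssZ = form_subspace_BC_cocycles and ssI = form_subspace_BC_coboundaries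
    and ssIe = form_subspace_BC_coboundaries_ev and ssIo = form_subspace_BC_coboundaries_od
  have "\<exists>F. quot_linear ?Z ?I ?Ze ?Ie F \<and> (\<forall>\<alpha>\<in>?Z. F (coset ?I \<alpha>) = coset ?Ie (?e \<alpha>))"
    by (intro quot_linear_induced ssZ ssI ssIe ev_part_BC_cocycles ev_part_BC_coboundaries
        ev_part_add ev_part_scale BC_cocycles_A)
  then obtain Fe where Fe: "quot_linear ?Z ?I ?Ze ?Ie Fe"
    and Fe_coset: "\<And>\<alpha>. \<alpha> \<in> ?Z \<Longrightarrow> Fe (coset ?I \<alpha>) = coset ?Ie (?e \<alpha>)" by blast
  have "\<exists>F. quot_linear ?Z ?I ?Zo ?Io F \<and> (\<forall>\<alpha>\<in>?Z. F (coset ?I \<alpha>) = coset ?Io (?o \<alpha>))"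
    by (intro quot_linear_induced ssZ ssI ssIo od_part_BC_cocycles od_part_BC_coboundaries
        od_part_add od_part_scale BC_cocycles_A)
  then obtain Fo where Fo: "quot_linear ?Z ?I ?Zo ?Io Fo"
    and Fo_coset: "\<And>\<alpha>. \<alpha> \<in> ?Z \<Longrightarrow> Fo (coset ?I \<alpha>) = coset ?Io (?o \<alpha>)" by blast
  have "bij_betw (\<lambda>C. (Fe C, Fo C)) (H_BC atlas J k) (H_BC_ev atlas J k \<times> H_BC_od atlas J k)"
    unfolding bij_betw_def
  proof
    show "inj_on (\<lambda>C. (Fe C, Fo C)) (H_BC atlas J k)"
      unfolding H_BC_def quot_def
    proof (rule inj_onI; elim imageE; hypsubst)
      fix \<alpha> \<beta> assume \<alpha>: "\<alpha> \<in> ?Z" and \<beta>: "\<beta> \<in> ?Z"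
        and eq: "(Fe (coset ?I \<alpha>), Fo (coset ?I \<alpha>)) = (Fe (coset ?I \<beta>), Fo (coset ?I \<beta>))"
      \<comment> \<open>Even and odd coboundaries are also coboundaries in the full sense, so the
        differences of both parts, and with them their sum \<open>\<alpha> - \<beta>\<close>, lie in
        \<open>?I\<close>.\<close>
      have "?e \<alpha> - ?e \<beta> \<in> ?I" "?o \<alpha> - ?o \<beta> \<in> ?I"
        using eq BC_coboundaries_ev_subset BC_coboundaries_od_subset
        by (auto simp: Fe_coset[OF \<alpha>] Fe_coset[OF \<beta>] Fo_coset[OF \<alpha>] Fo_coset[OF \<beta>]
            coset_eq_iff[OF ssIe] coset_eq_iff[OF ssIo])
      then have "(?e \<alpha> - ?e \<beta>) + (?o \<alpha> - ?o \<beta>) \<in> ?I" by (rule form_subspaceD(2)[OF ssI])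
      then have "\<alpha> - \<beta> \<in> ?I"
        unfolding add_diff_add[symmetric]
        by (simp only: ev_part_od_part[OF BC_cocycles_A[OF \<alpha>]] ev_part_od_part[OF BC_cocycles_A[OF \<beta>]])
      then show "coset ?I \<alpha> = coset ?I \<beta>" using coset_eq_iff[OF ssI] by blast
    qed
    show "(\<lambda>C. (Fe C, Fo C)) ` H_BC atlas J k = H_BC_ev atlas J k \<times> H_BC_od atlas J k"
    proof (intro equalityI subsetI)
      fix P assume "P \<in> (\<lambda>C. (Fe C, Fo C)) ` H_BC atlas J k"
      then show "P \<in> H_BC_ev atlas J k \<times> H_BC_od atlas J k"
        using Fe Fo by (auto simp: H_BC_def H_BC_ev_def H_BC_od_def quot_linear_def)
    next
      fix P assume "P \<in> H_BC_ev atlas J k \<times> H_BC_od atlas J k"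
      then obtain \<beta> \<gamma> where \<beta>: "\<beta> \<in> ?Ze" and \<gamma>: "\<gamma> \<in> ?Zo" and P: "P = (coset ?Ie \<beta>, coset ?Io \<gamma>)"
        by (auto simp: H_BC_ev_def H_BC_od_def quot_def)
      have *: "\<beta> \<in> ?Z" "\<beta> \<in> A_ev atlas J k" "\<gamma> \<in> ?Z" "\<gamma> \<in> A_od atlas J k"
        using \<beta> \<gamma> by (simp_all add: BC_cocycles_ev_def BC_cocycles_od_def)
      \<comment> \<open>The preimage of a pair of classes: \<open>\<beta>\<close> and
        \<open>\<gamma>\<close> are the even and odd parts of their sum.\<close>
      have sum: "\<beta> + \<gamma> \<in> ?Z" by (rule form_subspaceD(2)[OF ssZ *(1,3)])
      have "P = (Fe (coset ?I (\<beta> + \<gamma>)), Fo (coset ?I (\<beta> + \<gamma>)))"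
        unfolding P Fe_coset[OF sum] Fo_coset[OF sum]
        by (simp add: ev_part_sum[OF *(2,4)] od_part_sum[OF *(2,4)])
      moreover have "coset ?I (\<beta> + \<gamma>) \<in> H_BC atlas J k" using sum by (simp add: H_BC_def quot_def)
      ultimately show "P \<in> (\<lambda>C. (Fe C, Fo C)) ` H_BC atlas J k" by blast
    qed
  qed
  then show ?thesis using Fe Fo Fe_coset Fo_coset by blast
qed

text \<open>\<open>G\<close> is induced by the identity on representatives. The parts of a cocycle
  are again cocycles and hence separately d-closed, so the de Rham class of \<open>\<alpha>\<close>
  is the sum of two classes, as in the stated formula.\<close>

lemma Bott_Chern_to_de_Rham:
  "\<exists>G. quot_linear (BC_cocycles atlas J k) (BC_coboundaries atlas J k)
         (dR_cocycles atlas k) (dR_coboundaries atlas k) G \<and>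
     (\<forall>\<alpha>\<in>BC_cocycles atlas J k.
        ev_part atlas J k \<alpha> \<in> dR_cocycles atlas k \<and>
        od_part atlas J k \<alpha> \<in> dR_cocycles atlas k \<and>
        G (coset (BC_coboundaries atlas J k) \<alpha>) =
          coset (dR_coboundaries atlas k) (ev_part atlas J k \<alpha>) +
          coset (dR_coboundaries atlas k) (od_part atlas J k \<alpha>))"
proof -
  have "\<exists>G. quot_linear (BC_cocycles atlas J k) (BC_coboundaries atlas J k)
      (dR_cocycles atlas k) (dR_coboundaries atlas k) G \<and>
    (\<forall>\<alpha>\<in>BC_cocycles atlas J k.
      G (coset (BC_coboundaries atlas J k) \<alpha>) = coset (dR_coboundaries atlas k) \<alpha>)"
    using BC_coboundaries_dR_coboundaries
    by (intro quot_linear_induced form_subspace_BC_cocycles form_subspace_BC_coboundaries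
        form_subspace_dR_coboundaries BC_cocycles_dR_cocycles) auto
  moreover have "ev_part atlas J k \<alpha> \<in> dR_cocycles atlas k" "od_part atlas J k \<alpha> \<in> dR_cocycles atlas k"
    "coset (dR_coboundaries atlas k) \<alpha> = coset (dR_coboundaries atlas k) (ev_part atlas J k \<alpha>) +
      coset (dR_coboundaries atlas k) (od_part atlas J k \<alpha>)" if \<alpha>: "\<alpha> \<in> BC_cocycles atlas J k" for \<alpha>
    using ev_part_BC_cocycles[OF \<alpha>] od_part_BC_cocycles[OF \<alpha>]
    by (auto simp: coset_add[OF form_subspace_dR_coboundaries] ev_part_od_part[OF BC_cocycles_A[OF \<alpha>]]
        BC_cocycles_ev_def BC_cocycles_od_def intro: BC_cocycles_dR_cocycles)
  ultimately show ?thesis by metis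
qed

end

theorem corollary3p22:
  fixes X :: "'a topology"
    and atlas :: "('a, 'e::real_inner) chart set"
    and J :: "('a, 'e) endo_field"
    and m k :: nat
  assumes "almost_complex_manifold m X atlas J"
  shows "(\<exists>F_ev F_od.
           quot_linear (BC_cocycles atlas J k) (BC_coboundaries atlas J k)
             (BC_cocycles_ev atlas J k) (BC_coboundaries_ev atlas J k) F_ev \<and>
           quot_linear (BC_cocycles atlas J k) (BC_coboundaries atlas J k)
             (BC_cocycles_od atlas J k) (BC_coboundaries_od atlas J k) F_od \<and>
           (\<forall>\<alpha>\<in>BC_cocycles atlas J k.
              F_ev (coset (BC_coboundaries atlas J k) \<alpha>) =
                coset (BC_coboundaries_ev atlas J k) (ev_part atlas J k \<alpha>) \<and>
              F_od (coset (BC_coboundaries atlas J k) \<alpha>) =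
                coset (BC_coboundaries_od atlas J k) (od_part atlas J k \<alpha>)) \<and>
           bij_betw (\<lambda>C. (F_ev C, F_od C)) (H_BC atlas J k) (H_BC_ev atlas J k \<times> H_BC_od atlas J k)) \<and>
         (\<exists>G. quot_linear (BC_cocycles atlas J k) (BC_coboundaries atlas J k)
               (dR_cocycles atlas k) (dR_coboundaries atlas k) G \<and>
           (\<forall>\<alpha>\<in>BC_cocycles atlas J k.
              ev_part atlas J k \<alpha> \<in> dR_cocycles atlas k \<and>
              od_part atlas J k \<alpha> \<in> dR_cocycles atlas k \<and>
              G (coset (BC_coboundaries atlas J k) \<alpha>) =
                coset (dR_coboundaries atlas k) (ev_part atlas J k \<alpha>) +
                coset (dR_coboundaries atlas k) (od_part atlas J k \<alpha>)))"
proof -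
  interpret almost_complex "2 * m" X atlas J
    using assms by unfold_locales (simp_all add: almost_complex_manifold_def)
  show ?thesis
    by (intro conjI Bott_Chern_parity_decomposition Bott_Chern_to_de_Rham)
qed

end
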